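(* Let the standing assumptions (Gelfand triples, stochastic convolution, existence and regularity of solutions, one-sided nonlinear estimate with constants $C,\delta,c_\varepsilon$) described in the context hold. Let $u$ be a solution of $\partial_t u = Au+G(u)$ and, for $\varepsilon>0$, let $u_\varepsilon$ be a solution of $\partial_t u_\varepsilon = A_\varepsilon u_\varepsilon+F_\varepsilon(u_\varepsilon)+Q_\varepsilon\partial_t W$, both with the regularity required in the context, and let $Z_\varepsilon$ be the stochastic convolution. Then for all $T>0$ there is a constant $K>0$ such that for all sufficiently small $\varepsilon>0$ and for all $\gamma>0$ $$\mathbb{P}\Big(\sup_{[0,T]}\|u_\varepsilon-u-Z_\varepsilon\|^2>K\gamma\Big)\le \mathbb{P}\Big(\sup_{[0,T]}\|Z_\varepsilon\|_X>(2c_\varepsilon)^{-1}\Big)+\mathbb{P}\big(\|u(0)-u_\varepsilon(0)\|^2>\gamma\big)+\mathbb{P}\Big(\int_0^T\|\mathrm{Res}_\varepsilon(u)\|_{V_\varepsilon'}^2\,dt>\gamma\Big),$$ where $\mathrm{Res}_\varepsilon(u)(t)=\partial_t u(t)-A_\varepsilon u(t)-F_\varepsilon(u(t)+Z_\varepsilon(t))$.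
   Context: Setting. $H$ is a separable Hilbert space with norm $\|\cdot\|$, $W$ is a standard cylindrical Wiener process, $Q_\varepsilon$ is a linear operator (noise coefficient). Spaces: for all $\varepsilon>0$ there are a separable reflexive Banach space $V_\varepsilon$ with dual $V_\varepsilon'$, and a Banach space $X$ (independent of $\varepsilon$), with $V_\varepsilon\subset X\subset H\simeq H'\subset V_\varepsilon'$, all embeddings continuous and dense. Likewise there is a Gelfand triple $V\subset X\subset H\simeq H'\subset V'$ with dense continuous embeddings. Brackets $\langle\cdot,\cdot\rangle$ denote the corresponding dual pairings induced by $H\simeq H'$. Operators: $A:V\to V'$ and $A_\varepsilon:V_\varepsilon\to V_\varepsilon'$ are linear, $G:X\to V'$ and $F_\varepsilon:X\to V_\varepsilon'$ are (nonlinear) maps; all are measurable. $A_\varepsilon$ generates a $C_0$-semigroup $e^{tA_\varepsilon}$. Stochastic convolution: $Z_\varepsilon(t)=\int_0^t e^{(t-s)A_\varepsilon}Q_\varepsilon\,dW(s)$, assumed to belong $\mathbb{P}$-a.s. to $C^0([0,T];X)$ for every $\varepsilon>0$, $T>0$. Solutions: $u\in L^2([0,T],V)$ is a weak solution of $\partial_t u=Au+G(u)$, $u(0)=u_0\in H$, if for all $t\in[0,T]$ and all $v\in V$, $\langle u(t),v\rangle_H=\langle u_0,v\rangle_H+\int_0^t\langle Au(s),v\rangle ds+\int_0^t\langle G(u(s)),v\rangle ds$, all integrals being well defined. $u_\varepsilon$ solves $\partial_t u_\varepsilon=A_\varepsilon u_\varepsilon+F_\varepsilon(u_\varepsilon)+Q_\varepsilon\partial_tW$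 if $v_\varepsilon:=u_\varepsilon-Z_\varepsilon$ is a weak solution (in the same sense, with $V_\varepsilon,A_\varepsilon$ in place of $V,A$) of $\partial_t v_\varepsilon=A_\varepsilon v_\varepsilon+F_\varepsilon(v_\varepsilon+Z_\varepsilon)$. Existence and regularity assumption: such solutions exist with $u\in L^2([0,T],V)\cap C^0([0,T],X)$, $\partial_tu\in L^2([0,T],V')$; $v_\varepsilon\in L^2([0,T],V_\varepsilon)\cap C^0([0,T],X)$, $\partial_tv_\varepsilon\in L^2([0,T],V_\varepsilon')$; and $\varphi_\varepsilon=u-v_\varepsilon$ satisfies $\varphi_\varepsilon\in L^2([0,T],V_\varepsilon)$, $\partial_t\varphi_\varepsilon\in L^2([0,T],V_\varepsilon')$. The function $u$ is deterministic and independent of $\varepsilon$. Nonlinear estimate: there are constants $C\ge0$, $\delta>0$ (independent of $\varepsilon$) and $0\le c_\varepsilon\to0$ as $\varepsilon\to0$ such that $$\langle A_\varepsilon\varphi,\varphi\rangle+\langle F_\varepsilon(\varphi+\psi)-F_\varepsilon(\psi),\varphi\rangle\le-\delta\|\varphi\|_{V_\varepsilon}^2+C\|\varphi\|^2$$ for every $\varphi\in V_\varepsilon$ and $\psi\in X$ with $c_\varepsilon\|\psi\|_X\le1$. Conventions: the $V_\varepsilon'$-norm of the residual is $+\infty$ whenever the residual is not well defined in that space; if $c_\varepsilon=0$ then $1/c_\varepsilon=\infty$. For $c_\varepsilon>0$, "$\varepsilon$ sufficiently small" can be quantified by $\sup_{[0,T]}\|u\|_X\le(2c_\varepsilon)^{-1}$.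 *)

theory Defs
  imports "HOL-Probability.Probability"
begin

section \<open>Banach spaces embedded in a Hilbert space\<close>

text \<open>
  The Banach spaces of the Gelfand triples depend on the parameter \<open>\<epsilon>\<close> and so cannot be types.
  They are represented as linear subspaces of the Hilbert space, which is the type \<open>'h\<close>, each with
  a norm of its own; the embedding into \<open>'h\<close> is the inclusion. Values of \<open>nrm\<close> outside \<open>carr\<close> play
  no role: \<open>ndist\<close> is cut off there only because the library's \<open>Metric_space\<close> wants a symmetric and
  nonnegative function on the whole type.
\<close>

record 'h normed_sub =
  carr :: "'h set"
  nrm :: "'h \<Rightarrow> real"

definition ndist :: "'h::real_vector normed_sub \<Rightarrow> 'h \<Rightarrow> 'h \<Rightarrow> real" where
  "ndist X x y = (if x \<in> carr X \<and> y \<in> carr X then nrm X (x - y) else 0)"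

definition ntop :: "'h::real_vector normed_sub \<Rightarrow> 'h topology" where
  "ntop X = Metric_space.mtopology (carr X) (ndist X)"

definition nborel :: "'h::real_vector normed_sub \<Rightarrow> 'h measure" where
  "nborel X = sigma (carr X) {U. openin (ntop X) U}"

definition banach_sub :: "'h::real_vector normed_sub \<Rightarrow> bool" where
  "banach_sub X \<longleftrightarrow>
     subspace (carr X) \<and>
     (\<forall>x\<in>carr X. 0 \<le> nrm X x \<and> (nrm X x = 0 \<longleftrightarrow> x = 0)) \<and>
     (\<forall>x\<in>carr X. \<forall>a. nrm X (a *\<^sub>R x) = \<bar>a\<bar> * nrm X x) \<and>
     (\<forall>x\<in>carr X. \<forall>y\<in>carr X. nrm X (x + y) \<le> nrm X x + nrm X y) \<and>
     Metric_space.mcomplete (carr X) (ndist X)"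

lemma banach_sub_Metric_space:
  assumes "banach_sub X"
  shows "Metric_space (carr X) (ndist X)"
proof
  have sub: "subspace (carr X)"
    and nn: "\<And>x. x \<in> carr X \<Longrightarrow> 0 \<le> nrm X x"
    and z: "\<And>x. x \<in> carr X \<Longrightarrow> nrm X x = 0 \<longleftrightarrow> x = 0"
    and sc: "\<And>a x. x \<in> carr X \<Longrightarrow> nrm X (a *\<^sub>R x) = \<bar>a\<bar> * nrm X x"
    and tri: "\<And>x y. x \<in> carr X \<Longrightarrow> y \<in> carr X \<Longrightarrow> nrm X (x + y) \<le> nrm X x + nrm X y"
    using assms by (auto simp: banach_sub_def)
  show "0 \<le> ndist X x y" for x y
    by (auto simp: ndist_def nn sub subspace_diff)
  show "ndist X x y = ndist X y x" for x y
    using sc[of "x - y" "-1"] by (auto simp: ndist_def sub subspace_diff)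
  show "(ndist X x y = 0) = (x = y)" if "x \<in> carr X" "y \<in> carr X" for x y
    using that by (auto simp: ndist_def z sub subspace_diff)
  show "ndist X x w \<le> ndist X x y + ndist X y w"
    if "x \<in> carr X" "y \<in> carr X" "w \<in> carr X" for x y w
    using that tri[of "x - y" "y - w"] by (auto simp: ndist_def sub subspace_diff)
qed

definition enorm :: "'h normed_sub \<Rightarrow> 'h \<Rightarrow> ennreal" where
  "enorm X x = (if x \<in> carr X then ennreal (nrm X x) else \<infinity>)"

text \<open>
  Elements of the dual space are functionals on \<open>carr V\<close>; extending them by \<open>0\<close> makes two of them
  equal as functions iff they agree on \<open>carr V\<close>. The pairing \<open>\<langle>f, v\<rangle>\<close> is the application \<open>f v\<close>.
\<close>

definition dual :: "'h::real_vector normed_sub \<Rightarrow> ('h \<Rightarrow> real) set" where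
  "dual V = {f.
     (\<forall>x\<in>carr V. \<forall>y\<in>carr V. f (x + y) = f x + f y) \<and>
     (\<forall>x\<in>carr V. \<forall>a. f (a *\<^sub>R x) = a * f x) \<and>
     (\<exists>K. \<forall>x\<in>carr V. \<bar>f x\<bar> \<le> K * nrm V x) \<and>
     (\<forall>x. x \<notin> carr V \<longrightarrow> f x = 0)}"

definition dual_norm :: "'h::real_vector normed_sub \<Rightarrow> ('h \<Rightarrow> real) \<Rightarrow> real" where
  "dual_norm V f = (SUP x\<in>{x\<in>carr V. nrm V x \<le> 1}. \<bar>f x\<bar>)"

definition dual_enorm :: "'h::real_vector normed_sub \<Rightarrow> ('h \<Rightarrow> real) \<Rightarrow> ennreal" where
  "dual_enorm V f = (if f \<in> dual V then ennreal (dual_norm V f) else \<infinity>)"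

definition dual_dist :: "'h::real_vector normed_sub \<Rightarrow> ('h \<Rightarrow> real) \<Rightarrow> ('h \<Rightarrow> real) \<Rightarrow> real" where
  "dual_dist V f g = (if f \<in> dual V \<and> g \<in> dual V then dual_norm V (\<lambda>x. f x - g x) else 0)"

definition dual_top :: "'h::real_vector normed_sub \<Rightarrow> ('h \<Rightarrow> real) topology" where
  "dual_top V = Metric_space.mtopology (dual V) (dual_dist V)"

definition dual_borel :: "'h::real_vector normed_sub \<Rightarrow> ('h \<Rightarrow> real) measure" where
  "dual_borel V = sigma (dual V) {U. openin (dual_top V) U}"

text \<open>Surjectivity of the canonical map into the bidual.\<close>

definition reflexive_sub :: "'h::real_vector normed_sub \<Rightarrow> bool" where
  "reflexive_sub V \<longleftrightarrow>
     (\<forall>\<Phi> :: ('h \<Rightarrow> real) \<Rightarrow> real.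
        (\<forall>f\<in>dual V. \<forall>g\<in>dual V. \<Phi> (\<lambda>x. f x + g x) = \<Phi> f + \<Phi> g) \<and>
        (\<forall>f\<in>dual V. \<forall>a. \<Phi> (\<lambda>x. a * f x) = a * \<Phi> f) \<and>
        (\<exists>K. \<forall>f\<in>dual V. \<bar>\<Phi> f\<bar> \<le> K * dual_norm V f)
        \<longrightarrow> (\<exists>x\<in>carr V. \<forall>f\<in>dual V. \<Phi> f = f x))"

text \<open>The embedding \<open>H \<simeq> H' \<subset> V'\<close>.\<close>

definition riesz :: "'h::real_inner normed_sub \<Rightarrow> 'h \<Rightarrow> 'h \<Rightarrow> real" where
  "riesz V h = (\<lambda>v. if v \<in> carr V then inner h v else 0)"

definition gelfand_triple :: "'h::real_inner normed_sub \<Rightarrow> 'h normed_sub \<Rightarrow> bool" where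
  "gelfand_triple V X \<longleftrightarrow>
     banach_sub V \<and> separable_space (ntop V) \<and> reflexive_sub V \<and> banach_sub X \<and>
     continuous_map (ntop V) (ntop X) (\<lambda>x. x) \<and> (ntop X) closure_of (carr V) = carr X \<and>
     continuous_map (ntop X) euclidean (\<lambda>x. x) \<and> closure (carr X) = UNIV \<and>
     continuous_map euclidean (dual_top V) (riesz V) \<and>
     (dual_top V) closure_of (range (riesz V)) = dual V"

definition linear_to_dual :: "'h::real_vector normed_sub \<Rightarrow> ('h \<Rightarrow> 'h \<Rightarrow> real) \<Rightarrow> bool" where
  "linear_to_dual V A \<longleftrightarrow>
     (\<forall>x\<in>carr V. \<forall>y\<in>carr V. \<forall>a b. A (a *\<^sub>R x + b *\<^sub>R y) = (\<lambda>v. a * A x v + b * A y v))"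


section \<open>Functions of time with values in these spaces\<close>

text \<open>
  Lebesgue--Bochner \<open>L\<^sup>2\<close> functions on \<open>[0,T]\<close>, up to null sets. All target spaces used below are
  separable, so Borel measurability is strong measurability.
\<close>

definition L2_class :: "real \<Rightarrow> 'a measure \<Rightarrow> ('a \<Rightarrow> real) \<Rightarrow> (real \<Rightarrow> 'a) \<Rightarrow> bool" where
  "L2_class T B N f \<longleftrightarrow>
     (\<exists>w\<in>measurable (lebesgue_on {0..T}) B.
        (AE t in lebesgue_on {0..T}. f t = w t) \<and>
        (\<integral>\<^sup>+ t. ennreal ((N (w t))\<^sup>2) \<partial>lebesgue_on {0..T}) < \<infinity>)"

abbreviation L2_in :: "'h::real_vector normed_sub \<Rightarrow> real \<Rightarrow> (real \<Rightarrow> 'h) \<Rightarrow> bool" where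
  "L2_in V T \<equiv> L2_class T (nborel V) (nrm V)"

abbreviation L2_dual :: "'h::real_vector normed_sub \<Rightarrow> real \<Rightarrow> (real \<Rightarrow> 'h \<Rightarrow> real) \<Rightarrow> bool" where
  "L2_dual V T \<equiv> L2_class T (dual_borel V) (dual_norm V)"

definition C0_in :: "'h::real_vector normed_sub \<Rightarrow> real \<Rightarrow> (real \<Rightarrow> 'h) \<Rightarrow> bool" where
  "C0_in X T u \<longleftrightarrow> continuous_map (top_of_set {0..T}) (ntop X) u"

definition test_function :: "real \<Rightarrow> (real \<Rightarrow> real) \<Rightarrow> bool" where
  "test_function T \<eta> \<longleftrightarrow>
     (\<forall>n. (deriv ^^ n) \<eta> differentiable_on UNIV) \<and>
     (\<exists>a b. 0 < a \<and> b < T \<and> (\<forall>t. t \<notin> {a..b} \<longrightarrow> \<eta> t = 0))"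

text \<open>
  \<open>g\<close> is the distributional derivative of \<open>u\<close> on \<open>(0,T)\<close> and lies in \<open>L\<^sup>2([0,T],V')\<close>. The identity
  \<open>\<integral> \<eta>' u dt = - \<integral> \<eta> g dt\<close> in \<open>V'\<close> is written out by evaluating both sides at each \<open>v \<in> V\<close>.
\<close>

definition weak_derivative ::
    "'h::real_inner normed_sub \<Rightarrow> real \<Rightarrow> (real \<Rightarrow> 'h) \<Rightarrow> (real \<Rightarrow> 'h \<Rightarrow> real) \<Rightarrow> bool" where
  "weak_derivative V T u g \<longleftrightarrow>
     L2_dual V T g \<and>
     (\<forall>\<eta>. test_function T \<eta> \<longrightarrow>
        (\<forall>v\<in>carr V. (\<integral>t. deriv \<eta> t * inner (u t) v \<partial>lebesgue_on {0..T})
                    = - (\<integral>t. \<eta> t * g t v \<partial>lebesgue_on {0..T})))"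

text \<open>\<open>\<partial>\<^sub>t u\<close>, determined up to null sets by \<open>weak_derivative\<close>; arbitrary if no derivative exists.\<close>

definition time_deriv ::
    "'h::real_inner normed_sub \<Rightarrow> real \<Rightarrow> (real \<Rightarrow> 'h) \<Rightarrow> real \<Rightarrow> 'h \<Rightarrow> real" where
  "time_deriv V T u = (SOME g. weak_derivative V T u g)"

definition regular :: "'h::real_inner normed_sub \<Rightarrow> real \<Rightarrow> (real \<Rightarrow> 'h) \<Rightarrow> bool" where
  "regular V T u \<longleftrightarrow> L2_in V T u \<and> (\<exists>g. weak_derivative V T u g)"

text \<open>
  Weak solutions of \<open>\<partial>\<^sub>t u = A u + N t u\<close>, \<open>u(0) = u\<^sub>0\<close> on \<open>[0,T]\<close>; the time-dependent nonlinearity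
  covers both \<open>G(u)\<close> and \<open>F(v + Z(t))\<close>.
\<close>

definition weak_solution ::
    "'h::real_inner normed_sub \<Rightarrow> real \<Rightarrow> ('h \<Rightarrow> 'h \<Rightarrow> real) \<Rightarrow> (real \<Rightarrow> 'h \<Rightarrow> 'h \<Rightarrow> real)
      \<Rightarrow> 'h \<Rightarrow> (real \<Rightarrow> 'h) \<Rightarrow> bool" where
  "weak_solution V T A N u0 u \<longleftrightarrow>
     L2_in V T u \<and>
     (\<forall>t\<in>{0..T}. \<forall>v\<in>carr V.
        integrable (lebesgue_on {0..t}) (\<lambda>s. A (u s) v) \<and>
        integrable (lebesgue_on {0..t}) (\<lambda>s. N s (u s) v) \<and>
        inner (u t) v = inner u0 v + (\<integral>s. A (u s) v \<partial>lebesgue_on {0..t})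
                                   + (\<integral>s. N s (u s) v \<partial>lebesgue_on {0..t}))"

definition residual ::
    "'h::real_inner normed_sub \<Rightarrow> real \<Rightarrow> ('h \<Rightarrow> 'h \<Rightarrow> real) \<Rightarrow> ('h \<Rightarrow> 'h \<Rightarrow> real)
      \<Rightarrow> (real \<Rightarrow> 'h) \<Rightarrow> (real \<Rightarrow> 'h) \<Rightarrow> real \<Rightarrow> 'h \<Rightarrow> real" where
  "residual V T A F u z t = (\<lambda>v. time_deriv V T u t v - A (u t) v - F (u t + z t) v)"

text \<open>\<open>\<integral>\<^sub>0\<^sup>T \<parallel>Res(u)\<parallel>\<^sup>2 dt\<close> in the norm of \<open>V'\<close>, which counts as \<open>\<infinity>\<close> wherever the residual is not
  well defined in \<open>V'\<close>.\<close>

definition residual_sq_integral ::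
    "'h::real_inner normed_sub \<Rightarrow> 'h normed_sub \<Rightarrow> real \<Rightarrow> ('h \<Rightarrow> 'h \<Rightarrow> real)
      \<Rightarrow> ('h \<Rightarrow> 'h \<Rightarrow> real) \<Rightarrow> (real \<Rightarrow> 'h) \<Rightarrow> (real \<Rightarrow> 'h) \<Rightarrow> ennreal" where
  "residual_sq_integral V X T A F u z =
     (if \<exists>g. weak_derivative V T u g
      then \<integral>\<^sup>+ t. (if u t \<in> carr V \<and> u t + z t \<in> carr X
                  then (dual_enorm V (residual V T A F u z t))\<^sup>2 else \<infinity>) \<partial>lebesgue_on {0..T}
      else \<infinity>)"


section \<open>Semigroups\<close>

definition C0_semigroup :: "(real \<Rightarrow> 'h::real_normed_vector \<Rightarrow>\<^sub>L 'h) \<Rightarrow> bool" where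
  "C0_semigroup S \<longleftrightarrow>
     S 0 = id_blinfun \<and>
     (\<forall>s\<ge>0. \<forall>t\<ge>0. S (s + t) = S s o\<^sub>L S t) \<and>
     (\<forall>x. ((\<lambda>t. blinfun_apply (S t) x) \<longlongrightarrow> x) (at_right 0))"

text \<open>
  \<open>S\<close> is a \<open>C\<^sub>0\<close>-semigroup on \<open>H\<close> whose infinitesimal generator is the realization of \<open>A : V \<rightarrow> V'\<close>
  in \<open>H\<close>, that is, \<open>A\<close> restricted to \<open>{x \<in> V. A x \<in> H}\<close>.
\<close>

definition generates_C0_semigroup ::
    "'h::real_inner normed_sub \<Rightarrow> ('h \<Rightarrow> 'h \<Rightarrow> real) \<Rightarrow> (real \<Rightarrow> 'h \<Rightarrow>\<^sub>L 'h) \<Rightarrow> bool" where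
  "generates_C0_semigroup V A S \<longleftrightarrow>
     C0_semigroup S \<and>
     (\<forall>x y. ((\<lambda>t. (blinfun_apply (S t) x - x) /\<^sub>R t) \<longlongrightarrow> y) (at_right 0)
            \<longleftrightarrow> x \<in> carr V \<and> A x = riesz V y)"


section \<open>Cylindrical Wiener processes and the stochastic convolution\<close>

text \<open>
  A standard cylindrical Wiener process on a Hilbert space \<open>U\<close>, given by its coordinates
  \<open>W t x = \<langle>W(t), x\<rangle>\<close>, \<open>x \<in> U\<close>. In particular, for an orthonormal basis \<open>e\<^sub>k\<close> of \<open>U\<close> the processes
  \<open>W t e\<^sub>k\<close> are independent standard Brownian motions.
\<close>

definition cylindrical_wiener :: "'w measure \<Rightarrow> (real \<Rightarrow> 'k::real_inner \<Rightarrow> 'w \<Rightarrow> real) \<Rightarrow> bool" where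
  "cylindrical_wiener M W \<longleftrightarrow>
     prob_space M \<and>
     (\<forall>t\<ge>0. \<forall>x. W t x \<in> borel_measurable M) \<and>
     (\<forall>x. AE \<omega> in M. W 0 x \<omega> = 0) \<and>
     (\<forall>x. AE \<omega> in M. continuous_on {0..} (\<lambda>t. W t x \<omega>)) \<and>
     (\<forall>t\<ge>0. \<forall>x y a b. AE \<omega> in M. W t (a *\<^sub>R x + b *\<^sub>R y) \<omega> = a * W t x \<omega> + b * W t y \<omega>) \<and>
     (\<forall>s\<ge>0. \<forall>t>s. \<forall>x. x \<noteq> 0 \<longrightarrow>
        distributed M lborel (\<lambda>\<omega>. W t x \<omega> - W s x \<omega>)
          (\<lambda>r. ennreal (normal_density 0 (sqrt (t - s) * norm x) r))) \<and>
     (\<forall>s\<ge>0. \<forall>t>s. \<forall>x.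
        prob_space.indep_set M
          {(\<lambda>\<omega>. W t x \<omega> - W s x \<omega>) -` B \<inter> space M | B. B \<in> sets borel}
          (sigma_sets (space M)
             {W r y -` B \<inter> space M | r y B. 0 \<le> r \<and> r \<le> s \<and> B \<in> sets borel}))"

text \<open>
  The list entry \<open>(a, b, x, y)\<close> stands for the operator-valued step function
  \<open>s \<mapsto> 1\<^bsub>(a,b]\<^esub>(s) \<langle>x, \<cdot>\<rangle> y\<close>, whose stochastic integral is \<open>(W(b) x - W(a) x) y\<close>.
\<close>

type_synonym ('k, 'h) step_fun = "(real \<times> real \<times> 'k \<times> 'h) list"

definition step_op ::
    "('k::real_inner, 'h::real_vector) step_fun \<Rightarrow> real \<Rightarrow> 'k \<Rightarrow> 'h" where
  "step_op p s k = (\<Sum>(a, b, x, y)\<leftarrow>p. (indicator {a<..b} s * inner x k) *\<^sub>R y)"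

definition step_integral ::
    "(real \<Rightarrow> 'k \<Rightarrow> 'w \<Rightarrow> real) \<Rightarrow> ('k, 'h::real_vector) step_fun \<Rightarrow> 'w \<Rightarrow> 'h" where
  "step_integral W p \<omega> = (\<Sum>(a, b, x, y)\<leftarrow>p. (W b x \<omega> - W a x \<omega>) *\<^sub>R y)"

definition orthonormal_basis :: "'k::real_inner set \<Rightarrow> bool" where
  "orthonormal_basis E \<longleftrightarrow>
     pairwise orthogonal E \<and> (\<forall>e\<in>E. norm e = 1) \<and> closure (span E) = UNIV"

text \<open>Square of the Hilbert--Schmidt norm; it does not depend on the orthonormal basis \<open>E\<close>.\<close>

definition HS_sq :: "'k set \<Rightarrow> ('k \<Rightarrow> 'h::real_normed_vector) \<Rightarrow> ennreal" where
  "HS_sq E L = (\<integral>\<^sup>+ e. ennreal ((norm (L e))\<^sup>2) \<partial>count_space E)"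

text \<open>
  \<open>I = \<integral>\<^sub>0\<^sup>t \<Psi>(s) dW(s)\<close> for deterministic \<open>\<Psi>\<close>: \<open>I\<close> is the limit in \<open>L\<^sup>2(\<Omega>,H)\<close> of the integrals of
  step functions that converge to \<open>\<Psi>\<close> in \<open>L\<^sup>2([0,t], HS(U,H))\<close>.
\<close>

definition stochastic_integral ::
    "'w measure \<Rightarrow> (real \<Rightarrow> 'k::real_inner \<Rightarrow> 'w \<Rightarrow> real) \<Rightarrow> real
      \<Rightarrow> (real \<Rightarrow> 'k \<Rightarrow>\<^sub>L 'h::real_inner) \<Rightarrow> ('w \<Rightarrow> 'h) \<Rightarrow> bool" where
  "stochastic_integral M W t \<Psi> I \<longleftrightarrow>
     (\<forall>x. (\<lambda>s. blinfun_apply (\<Psi> s) x) \<in> borel_measurable (lebesgue_on {0..t})) \<and>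
     I \<in> borel_measurable M \<and>
     (\<exists>E p. orthonormal_basis E \<and>
        (\<forall>n. \<forall>(a, b, x, y)\<in>set (p n). 0 \<le> a \<and> a \<le> b \<and> b \<le> t) \<and>
        (\<lambda>n. \<integral>\<^sup>+ s. HS_sq E (\<lambda>x. blinfun_apply (\<Psi> s) x - step_op (p n) s x)
               \<partial>lebesgue_on {0..t}) \<longlonglongrightarrow> 0 \<and>
        (\<lambda>n. \<integral>\<^sup>+ \<omega>. ennreal ((norm (I \<omega> - step_integral W (p n) \<omega>))\<^sup>2) \<partial>M) \<longlonglongrightarrow> 0)"

text \<open>The noise coefficient may be unbounded, with dense domain \<open>D\<close>.\<close>

definition densely_defined_operator :: "'k::real_normed_vector set \<Rightarrow> ('k \<Rightarrow> 'h::real_vector) \<Rightarrow> bool" where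
  "densely_defined_operator D Q \<longleftrightarrow>
     subspace D \<and> closure D = UNIV \<and>
     (\<forall>x\<in>D. \<forall>y\<in>D. \<forall>a b. Q (a *\<^sub>R x + b *\<^sub>R y) = a *\<^sub>R Q x + b *\<^sub>R Q y)"

text \<open>
  \<open>I = \<integral>\<^sub>0\<^sup>t S(t-s) Q dW(s)\<close>. The integrand \<open>\<Psi> s\<close> is the bounded extension of \<open>S(t-s) Q\<close> from the
  dense domain of \<open>Q\<close> to \<open>U\<close>.
\<close>

definition stochastic_convolution ::
    "'w measure \<Rightarrow> (real \<Rightarrow> 'k::real_inner \<Rightarrow> 'w \<Rightarrow> real) \<Rightarrow> (real \<Rightarrow> 'h::real_inner \<Rightarrow>\<^sub>L 'h)
      \<Rightarrow> 'k set \<Rightarrow> ('k \<Rightarrow> 'h) \<Rightarrow> real \<Rightarrow> ('w \<Rightarrow> 'h) \<Rightarrow> bool" where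
  "stochastic_convolution M W S D Q t I \<longleftrightarrow>
     (\<exists>\<Psi>. (AE s in lebesgue_on {0..t}. \<forall>x\<in>D. blinfun_apply (\<Psi> s) x = blinfun_apply (S (t - s)) (Q x)) \<and>
           stochastic_integral M W t \<Psi> I)"


section \<open>Probabilities of events\<close>

text \<open>
  \<open>outer_prob M P\<close> is the probability of \<open>{\<omega>. P \<omega>}\<close> whenever that set is measurable, possibly only
  with respect to the completion of \<open>M\<close>. The outer measure is used because \<open>emeasure\<close> assigns \<open>0\<close>
  to nonmeasurable sets, and the events of interest, which involve solution paths that are only
  controlled almost surely, need not be measurable without further assumptions.
\<close>

definition outer_prob :: "'w measure \<Rightarrow> ('w \<Rightarrow> bool) \<Rightarrow> ennreal" where
  "outer_prob M P = outer_measure_of M {\<omega>\<in>space M. P \<omega>}"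

lemma outer_prob_eq_emeasure:
  "{\<omega>\<in>space M. P \<omega>} \<in> sets M \<Longrightarrow> outer_prob M P = emeasure M {\<omega>\<in>space M. P \<omega>}"
  by (simp add: outer_prob_def)

lemma outer_prob_eq_completion:
  assumes "{\<omega>\<in>space M. P \<omega>} \<in> sets (completion M)"
  shows "outer_prob M P = emeasure (completion M) {\<omega>\<in>space M. P \<omega>}"
proof (rule antisym)
  let ?A = "{\<omega>\<in>space M. P \<omega>}"
  obtain B where B: "B \<in> sets M" "?A \<subseteq> B" "outer_measure_of M ?A = emeasure M B"
    using outer_measure_of_attain[of ?A M] by auto
  have "emeasure (completion M) ?A \<le> emeasure (completion M) B"
    using B by (intro emeasure_mono) auto
  then show "emeasure (completion M) ?A \<le> outer_prob M P"
    using B by (simp add: outer_prob_def)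
  obtain C where C: "C \<in> sets M" "?A \<subseteq> C" "emeasure (completion M) ?A = emeasure M C"
    using completion_upper[OF assms] by auto
  show "outer_prob M P \<le> emeasure (completion M) ?A"
    using outer_measure_of_mono[OF C(2), of M] C by (simp add: outer_prob_def)
qed

end

theory Submission
  imports Defs
begin

text \<open>
  The estimate is pathwise. Write \<open>v = u\<^sub>\<epsilon> - Z\<^sub>\<epsilon>\<close>, \<open>\<phi> = u - v\<close> and \<open>q = \<parallel>\<phi>\<parallel>\<^sup>2\<close>. Comparing weak
  derivatives gives \<open>\<partial>\<^sub>t\<phi> = Res + A\<^sub>\<epsilon>\<phi> + F\<^sub>\<epsilon>(u + Z\<^sub>\<epsilon>) - F\<^sub>\<epsilon>(v + Z\<^sub>\<epsilon>)\<close>. The one-sided estimate, applied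
  to \<open>-\<phi>\<close> and \<open>\<psi> = u + Z\<^sub>\<epsilon>\<close> (for which \<open>c\<^sub>\<epsilon>\<parallel>\<psi>\<parallel>\<^sub>X \<le> 1\<close> when \<open>Z\<^sub>\<epsilon>\<close> is not large and \<open>\<epsilon>\<close> is small), and
  Young's inequality yield \<open>2 \<langle>\<partial>\<^sub>t\<phi>, \<phi>\<rangle> \<le> 2 C q + \<parallel>Res\<parallel>\<^sup>2 / (2\<delta>)\<close>. Since
  \<open>q(t) - q(0) \<le> 2 \<integral> \<langle>\<partial>\<^sub>t\<phi>, \<phi>\<rangle>\<close>, Gronwall's lemma bounds \<open>q\<close> by
  \<open>(q(0) + \<integral> \<parallel>Res\<parallel>\<^sup>2 / (2\<delta>)) exp(2 C T)\<close>.
\<close>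

section \<open>Normed subspaces and their duals\<close>

text \<open>The one-sided estimate restricts the size of its base point \<open>\<psi>\<close> only.
  With \<open>u + Z\<close> and increment \<open>-\<phi>\<close>, the condition concerns the given
  solution and the noise alone, and the sign is harmless because all terms are even in
  \<open>\<phi>\<close> up to exchanging the two values of \<open>F\<close>.

  The analytic difficulty is to test the equation with the moving vector \<open>\<phi>(t)\<close>:
  weak derivatives are tested against fixed vectors, with a null set that may depend on the vector.
  Separability of \<open>V\<close> yields one null set for a countable dense set of vectors, and
  domination by the dual norm carries convergence over to all of \<open>V\<close>. Gronwall's lemma
  needs only an upper bound on the growth of \<open>q\<close>, so backward difference quotients are
  enough: the term they discard is a square with a favourable sign.

  Events are compared path by path off a null set, so their measurability in \<omega> never
  enters.\<close>

lemma continuous_map_Lipschitz_mtopology: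
  fixes f :: "'a \<Rightarrow> real"
  assumes "Metric_space M d"
    and lip: "\<And>x y. x \<in> M \<Longrightarrow> y \<in> M \<Longrightarrow> \<bar>f x - f y\<bar> \<le> L * d x y"
  shows "continuous_map (Metric_space.mtopology M d) euclidean f"
proof -
  interpret Metric_space M d by fact
  have "openin mtopology {x \<in> M. f x \<in> S}" if "open S" for S
    unfolding openin_mtopology
  proof (intro conjI allI impI)
    fix x assume x: "x \<in> {x \<in> M. f x \<in> S}"
    then obtain e where e: "e > 0" "\<And>y. dist y (f x) < e \<Longrightarrow> y \<in> S"
      using \<open>open S\<close> by (auto simp: open_dist)
    \<comment> \<open>\<open>L\<close> may be zero or negative; \<open>\<bar>L\<bar> + 1\<close> is
      a positive substitute.\<close>
    have "mball x (e / (\<bar>L\<bar> + 1)) \<subseteq> {x \<in> M. f x \<in> S}"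
    proof
      fix y assume y: "y \<in> mball x (e / (\<bar>L\<bar> + 1))"
      then have "d x y * (\<bar>L\<bar> + 1) < e"
        by (simp add: pos_less_divide_eq)
      moreover have "\<bar>f x - f y\<bar> \<le> L * d x y"
        using lip y by auto
      moreover have "L * d x y \<le> d x y * (\<bar>L\<bar> + 1)"
        using mult_right_mono[of L "\<bar>L\<bar> + 1" "d x y"] by (simp add: mult.commute)
      ultimately show "y \<in> {x \<in> M. f x \<in> S}"
        using y e(2)[of "f y"] by (auto simp: dist_real_def)
    qed
    moreover have "e / (\<bar>L\<bar> + 1) > 0" using e by simp
    ultimately show "\<exists>r>0. mball x r \<subseteq> {x \<in> M. f x \<in> S}" by blast
  qed auto
  then show ?thesis
    by (simp add: continuous_map_def)
qed

lemma borel_measurable_Lipschitz_mtopology: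
  fixes f :: "'a \<Rightarrow> real"
  assumes M: "Metric_space M d"
    and lip: "\<And>x y. x \<in> M \<Longrightarrow> y \<in> M \<Longrightarrow> \<bar>f x - f y\<bar> \<le> L * d x y"
  shows "f \<in> borel_measurable (sigma M {U. openin (Metric_space.mtopology M d) U})"
proof -
  interpret Metric_space M d by fact
  have sub: "{U. openin mtopology U} \<subseteq> Pow M"
    using openin_subset by fastforce
  have "openin mtopology {x \<in> M. f x \<in> S}" if "open S" for S
    using continuous_map_Lipschitz_mtopology[OF M lip] that by (simp add: continuous_map_def)
  then show ?thesis
    using sub by (intro borel_measurableI) (auto simp: vimage_def Int_def conj_commute)
qed

lemma
  assumes "banach_sub V"
  shows banach_sub_subspace: "subspace (carr V)"
    and banach_sub_nrm_nonneg: "x \<in> carr V \<Longrightarrow> 0 \<le> nrm V x"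
    and banach_sub_nrm_eq_0: "x \<in> carr V \<Longrightarrow> nrm V x = 0 \<longleftrightarrow> x = 0"
    and banach_sub_nrm_scaleR: "x \<in> carr V \<Longrightarrow> nrm V (a *\<^sub>R x) = \<bar>a\<bar> * nrm V x"
    and banach_sub_nrm_add: "x \<in> carr V \<Longrightarrow> y \<in> carr V \<Longrightarrow> nrm V (x + y) \<le> nrm V x + nrm V y"
  using assms by (auto simp: banach_sub_def)

lemma banach_sub_nrm_diff_le:
  assumes "banach_sub V" "x \<in> carr V" "y \<in> carr V"
  shows "\<bar>nrm V x - nrm V y\<bar> \<le> nrm V (x - y)"
proof -
  have d: "x - y \<in> carr V" "y - x \<in> carr V"
    using assms by (auto simp: banach_sub_subspace subspace_diff)
  have "nrm V (y - x) = nrm V (x - y)"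
    using banach_sub_nrm_scaleR[OF assms(1) d(1), of "-1"] by simp
  then show ?thesis
    using banach_sub_nrm_add[OF assms(1) d(1) assms(3)] banach_sub_nrm_add[OF assms(1) d(2) assms(2)]
    by simp
qed

lemma space_nborel: "banach_sub V \<Longrightarrow> space (nborel V) = carr V"
  unfolding nborel_def ntop_def
  by (subst space_measure_of)
     (use openin_subset Metric_space.topspace_mtopology[OF banach_sub_Metric_space] in fastforce)+

lemma measurable_nrm: "banach_sub V \<Longrightarrow> nrm V \<in> borel_measurable (nborel V)"
  unfolding nborel_def ntop_def
  by (rule borel_measurable_Lipschitz_mtopology[where L = 1])
     (auto simp: banach_sub_Metric_space ndist_def banach_sub_nrm_diff_le)

text \<open>Supplies the countable family of test vectors: facts that hold at almost every time for
  each single vector then hold off one null set for all vectors of \<open>D\<close>, and extend from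
  there by density.\<close>

lemma separable_sub_countable_dense:
  assumes "banach_sub V" "separable_space (ntop V)"
  obtains D where "countable D" "D \<subseteq> carr V"
    "\<And>x e. x \<in> carr V \<Longrightarrow> 0 < e \<Longrightarrow> \<exists>d\<in>D. nrm V (x - d) < e"
proof -
  interpret Metric_space "carr V" "ndist V"
    using assms(1) by (rule banach_sub_Metric_space)
  obtain D where D: "countable D" "D \<subseteq> carr V" "mtopology closure_of D = carr V"
    using assms(2) by (auto simp: separable_space_def ntop_def)
  have "\<exists>d\<in>D. nrm V (x - d) < e" if "x \<in> carr V" "0 < e" for x e
  proof -
    have "x \<in> mtopology closure_of D" using D that by simp
    then obtain d where "d \<in> D" "d \<in> mball x e"
      using \<open>0 < e\<close> by (auto simp: metric_closure_of)
    then show ?thesis by (auto simp: ndist_def)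
  qed
  with D that show ?thesis by blast
qed

section \<open>Bounded functionals and the metric of the dual\<close>

lemma dual_apply_diff:
  assumes "f \<in> dual V" "banach_sub V" "x \<in> carr V" "y \<in> carr V"
  shows "f (x - y) = f x - f y"
proof -
  have "f (x + (-1) *\<^sub>R y) = f x + f ((-1) *\<^sub>R y)"
    using assms subspace_scale[OF banach_sub_subspace[OF assms(2)] assms(4), of "-1"]
    unfolding dual_def by blast
  also have "f ((-1) *\<^sub>R y) = -1 * f y"
    using assms unfolding dual_def by blast
  finally show ?thesis by simp
qed

text \<open>A real supremum is meaningful only over a set bounded above; every use of
  \<open>cSUP_upper\<close> for \<open>dual_norm\<close> rests on this.\<close>

lemma dual_bdd_above:
  assumes "f \<in> dual V" "banach_sub V"
  shows "bdd_above ((\<lambda>x. \<bar>f x\<bar>) ` {x \<in> carr V. nrm V x \<le> 1})"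
proof -
  obtain K where K: "\<forall>x\<in>carr V. \<bar>f x\<bar> \<le> K * nrm V x"
    using assms by (auto simp: dual_def)
  have "\<bar>f x\<bar> \<le> \<bar>K\<bar>" if "x \<in> carr V" "nrm V x \<le> 1" for x
  proof -
    have "\<bar>f x\<bar> \<le> K * nrm V x" using K that by blast
    also have "\<dots> \<le> \<bar>K\<bar> * nrm V x"
      using banach_sub_nrm_nonneg[OF assms(2) that(1)] by (intro mult_right_mono) auto
    also have "\<dots> \<le> \<bar>K\<bar>" using that by (simp add: mult_left_le)
    finally show ?thesis .
  qed
  then show ?thesis by (intro bdd_aboveI2) auto
qed

lemma dual_norm_bound:
  assumes "f \<in> dual V" "banach_sub V" "x \<in> carr V"
  shows "\<bar>f x\<bar> \<le> dual_norm V f * nrm V x"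
proof (cases "x = 0")
  case True
  then show ?thesis
    using dual_apply_diff[OF assms(1,2), of 0 0] assms banach_sub_nrm_eq_0[OF assms(2,3)] by simp
next
  case False
  then have p: "nrm V x > 0"
    using banach_sub_nrm_nonneg[OF assms(2,3)] banach_sub_nrm_eq_0[OF assms(2,3)] by simp
  let ?y = "(1 / nrm V x) *\<^sub>R x"
  have y: "?y \<in> carr V" "nrm V ?y \<le> 1"
    using assms p by (auto simp: subspace_scale banach_sub_subspace banach_sub_nrm_scaleR)
  have "\<bar>f ?y\<bar> \<le> dual_norm V f"
    unfolding dual_norm_def using y by (intro cSUP_upper dual_bdd_above assms) auto
  moreover have "f ?y = (1 / nrm V x) * f x"
    using assms unfolding dual_def by blast
  ultimately show ?thesis
    using p by (simp add: abs_mult field_simps)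
qed

text \<open>No linearity of \<open>f\<close> is involved: the unit ball contains 0, so the supremum
  is over a nonempty set and is at most any upper bound.\<close>

lemma dual_norm_le:
  assumes "banach_sub V" "\<And>x. x \<in> carr V \<Longrightarrow> nrm V x \<le> 1 \<Longrightarrow> \<bar>f x\<bar> \<le> K"
  shows "dual_norm V f \<le> K"
proof -
  have "0 \<in> {x \<in> carr V. nrm V x \<le> 1}"
    using assms(1) banach_sub_nrm_eq_0[OF assms(1), of 0]
    by (auto simp: subspace_0 banach_sub_subspace)
  then show ?thesis
    unfolding dual_norm_def using assms(2) by (intro cSUP_least) auto
qed

lemma dual_norm_nonneg:
  assumes "f \<in> dual V" "banach_sub V"
  shows "0 \<le> dual_norm V f"
proof -
  have "0 \<in> carr V" "nrm V 0 = 0"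
    using assms(2) banach_sub_nrm_eq_0[OF assms(2), of 0]
    by (auto simp: subspace_0 banach_sub_subspace)
  then have "\<bar>f 0\<bar> \<le> dual_norm V f"
    unfolding dual_norm_def by (intro cSUP_upper dual_bdd_above assms) auto
  then show ?thesis by linarith
qed

lemma dual_diff:
  assumes "f \<in> dual V" "g \<in> dual V"
  shows "(\<lambda>x. f x - g x) \<in> dual V"
proof -
  obtain K L where "\<forall>x\<in>carr V. \<bar>f x\<bar> \<le> K * nrm V x" "\<forall>x\<in>carr V. \<bar>g x\<bar> \<le> L * nrm V x"
    using assms by (auto simp: dual_def)
  then have "\<forall>x\<in>carr V. \<bar>f x - g x\<bar> \<le> (K + L) * nrm V x"
    by (fastforce simp: distrib_right)
  then have "\<exists>M. \<forall>x\<in>carr V. \<bar>f x - g x\<bar> \<le> M * nrm V x" ..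
  then show ?thesis
    using assms unfolding dual_def by (auto simp: right_diff_distrib)
qed

text \<open>Separation of points relies on the convention that functionals vanish outside
  \<open>carr V\<close>: distance zero by itself forces agreement on \<open>carr V\<close>
  only.\<close>

lemma dual_Metric_space:
  assumes V: "banach_sub V"
  shows "Metric_space (dual V) (dual_dist V)"
proof
  show "0 \<le> dual_dist V f g" for f g
    by (simp add: dual_dist_def dual_norm_nonneg dual_diff V)
  show "dual_dist V f g = dual_dist V g f" for f g
    by (auto simp: dual_dist_def dual_norm_def abs_minus_commute)
  show "(dual_dist V f g = 0) = (f = g)" if "f \<in> dual V" "g \<in> dual V" for f g
  proof
    assume "dual_dist V f g = 0"
    then have z: "dual_norm V (\<lambda>x. f x - g x) = 0" using that by (simp add: dual_dist_def)
    show "f = g"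
    proof
      fix x
      show "f x = g x"
      proof (cases "x \<in> carr V")
        case True
        then show ?thesis
          using dual_norm_bound[OF dual_diff[OF that] V True] z by simp
      next
        case False
        then show ?thesis using that by (simp add: dual_def)
      qed
    qed
  next
    assume "f = g"
    moreover have "dual_norm V (\<lambda>x. f x - f x) \<le> 0"
      by (rule dual_norm_le[OF V]) simp
    ultimately show "dual_dist V f g = 0"
      using dual_norm_nonneg[OF dual_diff[OF that(1) that(1)] V] that by (simp add: dual_dist_def)
  qed
  show "dual_dist V f h \<le> dual_dist V f g + dual_dist V g h"
    if "f \<in> dual V" "g \<in> dual V" "h \<in> dual V" for f g h
  proof -
    have "dual_norm V (\<lambda>x. f x - h x) \<le> dual_norm V (\<lambda>x. f x - g x) + dual_norm V (\<lambda>x. g x - h x)"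
    proof (rule dual_norm_le[OF V])
      fix x assume x: "x \<in> carr V" "nrm V x \<le> 1"
      have "\<bar>e x\<bar> \<le> dual_norm V e" if "e \<in> dual V" for e
        unfolding dual_norm_def using x that V by (intro cSUP_upper dual_bdd_above) auto
      from this[OF dual_diff[OF that(1,2)]] this[OF dual_diff[OF that(2,3)]]
      show "\<bar>f x - h x\<bar> \<le> dual_norm V (\<lambda>x. f x - g x) + dual_norm V (\<lambda>x. g x - h x)" by linarith
    qed
    then show ?thesis using that by (simp add: dual_dist_def)
  qed
qed

lemma space_dual_borel: "banach_sub V \<Longrightarrow> space (dual_borel V) = dual V"
  unfolding dual_borel_def dual_top_def
  by (subst space_measure_of)
     (use openin_subset Metric_space.topspace_mtopology[OF dual_Metric_space] in fastforce)+

lemma measurable_dual_norm: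
  assumes "banach_sub V"
  shows "dual_norm V \<in> borel_measurable (dual_borel V)"
  unfolding dual_borel_def dual_top_def
proof (rule borel_measurable_Lipschitz_mtopology[where L = 1])
  have *: "dual_norm V f - dual_norm V g \<le> dual_dist V f g" if "f \<in> dual V" "g \<in> dual V" for f g
  proof -
    have "dual_norm V f \<le> dual_norm V g + dual_norm V (\<lambda>x. f x - g x)"
    proof (rule dual_norm_le[OF assms])
      fix x assume x: "x \<in> carr V" "nrm V x \<le> 1"
      have "\<bar>e x\<bar> \<le> dual_norm V e" if "e \<in> dual V" for e
        unfolding dual_norm_def using x that assms by (intro cSUP_upper dual_bdd_above) auto
      from this[OF dual_diff[OF that]] this[OF that(2)]
      show "\<bar>f x\<bar> \<le> dual_norm V g + dual_norm V (\<lambda>x. f x - g x)" by linarith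
    qed
    then show ?thesis using that by (simp add: dual_dist_def)
  qed
  show "\<bar>dual_norm V f - dual_norm V g\<bar> \<le> 1 * dual_dist V f g" if "f \<in> dual V" "g \<in> dual V" for f g
    using *[OF that] *[OF that(2,1)] Metric_space.commute[OF dual_Metric_space[OF assms], of f g]
    by simp
qed (rule dual_Metric_space[OF assms])

text \<open>Evaluation at a point is Lipschitz in the dual norm. This turns Borel measurability of a
  curve in the dual into measurability of its pairings with fixed vectors.\<close>

lemma measurable_dual_eval:
  assumes "banach_sub V" "x \<in> carr V"
  shows "(\<lambda>f. f x) \<in> borel_measurable (dual_borel V)"
  unfolding dual_borel_def dual_top_def
proof (rule borel_measurable_Lipschitz_mtopology[where L = "nrm V x"])
  show "\<bar>f x - g x\<bar> \<le> nrm V x * dual_dist V f g" if "f \<in> dual V" "g \<in> dual V" for f g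
    using dual_norm_bound[OF dual_diff[OF that] assms] that by (simp add: dual_dist_def mult.commute)
qed (rule dual_Metric_space[OF assms(1)])

lemma dual_eqI_dense:
  assumes "banach_sub V" "f \<in> dual V" "g \<in> dual V" "D \<subseteq> carr V"
    and dense: "\<And>x e. x \<in> carr V \<Longrightarrow> 0 < e \<Longrightarrow> \<exists>d\<in>D. nrm V (x - d) < e"
    and eq: "\<And>d. d \<in> D \<Longrightarrow> f d = g d"
  shows "f = g"
proof
  fix x
  show "f x = g x"
  proof (cases "x \<in> carr V")
    case True
    define h where "h = (\<lambda>x. f x - g x)"
    have h: "h \<in> dual V" unfolding h_def by (rule dual_diff[OF assms(2,3)])
    have "\<bar>h x\<bar> \<le> 0 + e" if "e > 0" for e
    proof -
      \<comment> \<open>Adding 1 allows division by \<open>N\<close> even if the norm of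
        \<open>h\<close> is zero.\<close>
      define N where "N = dual_norm V h + 1"
      have N: "N > 0" using dual_norm_nonneg[OF h assms(1)] by (simp add: N_def)
      obtain d where d: "d \<in> D" "nrm V (x - d) < e / N"
        using dense[OF True, of "e / N"] \<open>e > 0\<close> N by auto
      have dV: "d \<in> carr V" "x - d \<in> carr V"
        using d True assms by (auto intro: subspace_diff banach_sub_subspace)
      have "\<bar>h x\<bar> = \<bar>h (x - d)\<bar>"
        using dual_apply_diff[OF h assms(1) True dV(1)] eq[OF d(1)] by (simp add: h_def)
      also have "\<dots> \<le> dual_norm V h * nrm V (x - d)"
        by (rule dual_norm_bound[OF h assms(1) dV(2)])
      also have "\<dots> \<le> N * nrm V (x - d)"
        using banach_sub_nrm_nonneg[OF assms(1) dV(2)] by (intro mult_right_mono) (auto simp: N_def)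
      also have "\<dots> \<le> e" using d(2) N by (simp add: field_simps)
      finally show ?thesis by simp
    qed
    then have "\<bar>h x\<bar> \<le> 0" by (rule field_le_epsilon)
    then show ?thesis by (simp add: h_def)
  next
    case False
    then show ?thesis using assms by (simp add: dual_def)
  qed
qed

section \<open>Smooth cutoff functions\<close>

text \<open>Differentiating \<open>exp (- 1 / x)\<close> produces powers of \<open>1 / x\<close>;
  with the power built in as an index, derivatives are linear combinations within the same
  family.\<close>

definition exp_bump :: "nat \<Rightarrow> real \<Rightarrow> real" where
  "exp_bump k x = (if x \<le> 0 then 0 else exp (- 1 / x) / x ^ k)"

lemma exp_bump_tendsto_0: "(exp_bump k \<longlongrightarrow> 0) (at_right 0)"
proof -
  have "((\<lambda>x::real. inverse x ^ k / exp (inverse x)) \<longlongrightarrow> 0) (at_right 0)"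
    by (rule filterlim_compose[OF tendsto_power_div_exp_0 filterlim_inverse_at_top_right])
  moreover have "\<forall>\<^sub>F x in at_right 0. inverse x ^ k / exp (inverse x) = exp_bump k x"
    by (auto simp: eventually_at_right_less exp_bump_def exp_minus field_simps
        intro: eventually_mono[OF eventually_at_right_less[of "0::real"]])
  ultimately show ?thesis
    by (rule Lim_transform_eventually)
qed

lemma DERIV_exp_bump:
  "(exp_bump k has_real_derivative exp_bump (k + 2) x - real k * exp_bump (k + 1) x) (at x)"
proof -
  consider "x < 0" | "x = 0" | "x > 0" by linarith
  then show ?thesis
  proof cases
    case 1
    have "((\<lambda>_. 0) has_real_derivative 0) (at x)" by simp
    then have "(exp_bump k has_real_derivative 0) (at x)"
      by (rule has_field_derivative_transform_within_open[of _ _ _ "{..<0}"])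
         (use 1 in \<open>auto simp: exp_bump_def\<close>)
    then show ?thesis using 1 by (simp add: exp_bump_def)
  next
    case 2
    have "((\<lambda>h. exp_bump k h / h) \<longlongrightarrow> 0) (at_left 0)"
      by (rule Lim_transform_eventually[where f = "\<lambda>_. 0"])
         (auto simp: exp_bump_def eventually_at_filter)
    \<comment> \<open>Division by \<open>h\<close> raises the index by one, so the right difference
      quotient at 0 is \<open>exp_bump (Suc k)\<close> itself.\<close>
    moreover have "((\<lambda>h. exp_bump k h / h) \<longlongrightarrow> 0) (at_right 0)"
      by (rule Lim_transform_eventually[OF exp_bump_tendsto_0[of "Suc k"]])
         (auto simp: exp_bump_def field_simps intro: eventually_mono[OF eventually_at_right_less])
    ultimately have "((\<lambda>h. exp_bump k h / h) \<longlongrightarrow> 0) (at 0)"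
      by (simp add: filterlim_at_split)
    then show ?thesis using 2 by (simp add: DERIV_def, simp add: exp_bump_def)
  next
    case 3
    have "((\<lambda>x. exp (- 1 / x) / x ^ k) has_real_derivative
        exp_bump (k + 2) x - real k * exp_bump (k + 1) x) (at x)"
    proof (rule DERIV_cong)
      show "((\<lambda>x. exp (- 1 / x) / x ^ k) has_real_derivative
          ((exp (- 1 / x) * (1 / (x * x))) * x ^ k - exp (- 1 / x) * (real k * x ^ (k - 1))) / (x ^ k * x ^ k)) (at x)"
        by (rule DERIV_divide) (use 3 in \<open>auto intro!: derivative_eq_intros\<close>)
      \<comment> \<open>The exponent \<open>k - 1\<close> is truncated at \<open>k = 0\<close>,
        where the factor \<open>real k\<close> vanishes; hence the case split on
        \<open>k\<close>.\<close>
      show "((exp (- 1 / x) * (1 / (x * x))) * x ^ k - exp (- 1 / x) * (real k * x ^ (k - 1))) / (x ^ k * x ^ k)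
          = exp_bump (k + 2) x - real k * exp_bump (k + 1) x"
        using 3 by (cases k) (auto simp: exp_bump_def field_simps)
    qed
    then show ?thesis
      by (rule has_field_derivative_transform_within_open[of _ _ _ "{0<..}"])
         (use 3 in \<open>auto simp: exp_bump_def\<close>)
  qed
qed

lemma exp_bump_nonneg: "exp_bump k x \<ge> 0"
  by (simp add: exp_bump_def)

lemma exp_bump_pos: "x > 0 \<Longrightarrow> exp_bump k x > 0"
  by (simp add: exp_bump_def)

text \<open>Closure under derivatives is proved by rule induction, so no iterated Leibniz rule is needed.\<close>

inductive bump_algebra :: "(real \<Rightarrow> real) \<Rightarrow> bool" where
  bump: "bump_algebra (\<lambda>x. exp_bump k (a * x + b))"
| const: "bump_algebra (\<lambda>x. c)"
| add: "bump_algebra f \<Longrightarrow> bump_algebra g \<Longrightarrow> bump_algebra (\<lambda>x. f x + g x)"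
| mult: "bump_algebra f \<Longrightarrow> bump_algebra g \<Longrightarrow> bump_algebra (\<lambda>x. f x * g x)"
| inverse: "bump_algebra f \<Longrightarrow> (\<And>x. f x \<noteq> 0) \<Longrightarrow> bump_algebra (\<lambda>x. inverse (f x))"

lemma bump_algebra_cmult: "bump_algebra f \<Longrightarrow> bump_algebra (\<lambda>x. c * f x)"
  by (rule bump_algebra.mult[OF bump_algebra.const])

lemma bump_algebra_DERIV:
  "bump_algebra f \<Longrightarrow> \<exists>f'. bump_algebra f' \<and> (\<forall>x. (f has_real_derivative f' x) (at x))"
proof (induction rule: bump_algebra.induct)
  case (bump k a b)
  let ?d = "\<lambda>x. a * (exp_bump (k + 2) (a * x + b) + (- real k) * exp_bump (k + 1) (a * x + b))"
  have "bump_algebra ?d"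
    by (intro bump_algebra_cmult bump_algebra.add bump_algebra.bump)
  moreover have "((\<lambda>x. exp_bump k (a * x + b)) has_real_derivative ?d x) (at x)" for x
  proof -
    have "((\<lambda>x. a * x + b) has_real_derivative a) (at x)"
      by (auto intro!: derivative_eq_intros)
    from DERIV_chain2[OF DERIV_exp_bump this] show ?thesis
      by (simp add: mult.commute)
  qed
  ultimately show ?case by blast
next
  case (const c)
  show ?case by (intro exI[of _ "\<lambda>_. 0"]) (auto intro: bump_algebra.const)
next
  case (add f g)
  then obtain f' g' where "bump_algebra f'" "bump_algebra g'"
    "\<And>x. (f has_real_derivative f' x) (at x)" "\<And>x. (g has_real_derivative g' x) (at x)"
    by blast
  then show ?case
    by (intro exI[of _ "\<lambda>x. f' x + g' x"]) (auto intro: bump_algebra.add derivative_intros)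
next
  case (mult f g)
  then obtain f' g' where "bump_algebra f'" "bump_algebra g'"
    "\<And>x. (f has_real_derivative f' x) (at x)" "\<And>x. (g has_real_derivative g' x) (at x)"
    by blast
  with mult show ?case
    by (intro exI[of _ "\<lambda>x. f' x * g x + g' x * f x"])
       (auto intro!: bump_algebra.add bump_algebra.mult DERIV_mult)
next
  case (inverse f)
  then obtain f' where f': "bump_algebra f'" "\<And>x. (f has_real_derivative f' x) (at x)"
    by blast
  \<comment> \<open>Written with products and inverses only, so that the rules of
    \<open>bump_algebra\<close> apply to it as it stands.\<close>
  let ?d = "\<lambda>x. (- 1) * (inverse (f x) * f' x * inverse (f x))"
  have "bump_algebra ?d"
    using inverse f' by (intro bump_algebra_cmult bump_algebra.mult bump_algebra.inverse)
  moreover have "((\<lambda>x. inverse (f x)) has_real_derivative ?d x) (at x)" for x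
    using DERIV_inverse'[OF f'(2)[of x] inverse.hyps(2)] by simp
  ultimately show ?case by blast
qed

lemma bump_algebra_deriv:
  assumes "bump_algebra f"
  shows "bump_algebra (deriv f)" "(f has_real_derivative deriv f x) (at x)"
proof -
  obtain f' where f': "bump_algebra f'" "\<And>x. (f has_real_derivative f' x) (at x)"
    using bump_algebra_DERIV[OF assms] by blast
  then have "deriv f = f'" by (auto intro: DERIV_imp_deriv)
  with f' show "bump_algebra (deriv f)" "(f has_real_derivative deriv f x) (at x)" by auto
qed

lemma bump_algebra_funpow_deriv: "bump_algebra f \<Longrightarrow> bump_algebra ((deriv ^^ n) f)"
  by (induction n) (auto intro: bump_algebra_deriv)

lemma bump_algebra_differentiable: "bump_algebra f \<Longrightarrow> f differentiable_on A"
  by (meson bump_algebra_deriv(2) differentiable_at_imp_differentiable_on real_differentiable_def)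

lemma bump_algebra_continuous: "bump_algebra f \<Longrightarrow> continuous_on A f"
  by (intro differentiable_imp_continuous_on bump_algebra_differentiable)

text \<open>The standard smooth transition from 0 to 1 across the unit interval, with
  \<open>inverse\<close> in place of a quotient to match the rules of
  \<open>bump_algebra\<close>.\<close>

definition smooth_step :: "real \<Rightarrow> real" where
  "smooth_step x = exp_bump 0 x * inverse (exp_bump 0 x + exp_bump 0 (1 - x))"

lemma smooth_step_denom_pos: "exp_bump 0 x + exp_bump 0 (1 - x) > 0"
proof (cases "x > 0")
  case True
  then show ?thesis using exp_bump_pos[of x 0] exp_bump_nonneg[of 0 "1 - x"] by linarith
next
  case False
  then show ?thesis using exp_bump_pos[of "1 - x" 0] exp_bump_nonneg[of 0 x] by simp
qed

lemma smooth_step_0: "x \<le> 0 \<Longrightarrow> smooth_step x = 0"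
  by (simp add: smooth_step_def exp_bump_def)

lemma smooth_step_1: "x \<ge> 1 \<Longrightarrow> smooth_step x = 1"
  using smooth_step_denom_pos[of x] by (simp add: smooth_step_def exp_bump_def)

lemma smooth_step_bounds: "0 \<le> smooth_step x" "smooth_step x \<le> 1"
  using smooth_step_denom_pos[of x] exp_bump_nonneg[of 0 x] exp_bump_nonneg[of 0 "1 - x"]
  by (auto simp: smooth_step_def field_simps)

lemma bump_algebra_smooth_step: "bump_algebra (\<lambda>x. smooth_step (a * x + b))"
proof -
  have "bump_algebra (\<lambda>x. exp_bump 0 (a * x + b) *
      inverse (exp_bump 0 (a * x + b) + exp_bump 0 ((- a) * x + (1 - b))))"
  proof (intro bump_algebra.intros)
    fix x
    show "exp_bump 0 (a * x + b) + exp_bump 0 ((- a) * x + (1 - b)) \<noteq> 0"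
      using smooth_step_denom_pos[of "a * x + b"] by (simp add: algebra_simps)
  qed
  then show ?thesis by (simp add: smooth_step_def algebra_simps)
qed

lemma smooth_step_DERIV:
  "(smooth_step has_real_derivative deriv smooth_step x) (at x)"
  using bump_algebra_deriv(2)[OF bump_algebra_smooth_step[of 1 0]] by simp

text \<open>In the quotient rule the terms of mixed sign cancel and a sum of products of nonnegative
  functions remains. The sign is what makes the rescaled derivative an averaging kernel.\<close>

lemma deriv_smooth_step_nonneg: "deriv smooth_step x \<ge> 0"
proof -
  let ?e = "exp_bump 0" and ?f = "exp_bump 2"
  have d: "(?e has_real_derivative ?f y) (at y)" for y
    using DERIV_exp_bump[of 0 y] by (simp add: numeral_2_eq_2)
  have "((\<lambda>x::real. 1 - x) has_real_derivative - 1) (at x)"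
    by (auto intro!: derivative_eq_intros)
  from DERIV_chain2[OF d this]
  have d': "((\<lambda>x. ?e (1 - x)) has_real_derivative - ?f (1 - x)) (at x)" by simp
  let ?s = "?e x + ?e (1 - x)"
  have "((\<lambda>x. ?e x / (?e x + ?e (1 - x))) has_real_derivative
      (?f x * ?s - ?e x * (?f x + - ?f (1 - x))) / (?s * ?s)) (at x)"
    using smooth_step_denom_pos[of x] by (intro DERIV_divide DERIV_add d d') simp
  moreover have "(\<lambda>x. ?e x / (?e x + ?e (1 - x))) = smooth_step"
    by (auto simp: smooth_step_def field_simps)
  ultimately have "deriv smooth_step x = (?f x * ?s - ?e x * (?f x + - ?f (1 - x))) / (?s * ?s)"
    by (simp add: DERIV_imp_deriv)
  also have "\<dots> = (?f x * ?e (1 - x) + ?e x * ?f (1 - x)) / (?s * ?s)"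
    by (simp add: algebra_simps)
  also have "\<dots> \<ge> 0"
    by (intro divide_nonneg_nonneg add_nonneg_nonneg mult_nonneg_nonneg exp_bump_nonneg)
  finally show ?thesis .
qed

lemma deriv_smooth_step_0:
  assumes "x < 0 \<or> x > 1"
  shows "deriv smooth_step x = 0"
proof -
  have "((\<lambda>_. smooth_step x) has_real_derivative 0) (at x)" by simp
  then have "(smooth_step has_real_derivative 0) (at x)"
    by (rule has_field_derivative_transform_within_open[of _ _ _ "if x < 0 then {..<0} else {1<..}"])
       (use assms in \<open>auto simp: smooth_step_0 smooth_step_1 split: if_splits\<close>)
  then show ?thesis by (rule DERIV_imp_deriv)
qed

section \<open>The fundamental theorem for weak derivatives\<close>

lemma integrable_lebesgue_on_subset:
  fixes f :: "real \<Rightarrow> real"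
  assumes "integrable (lebesgue_on B) f" "A \<subseteq> B" "A \<in> sets lebesgue" "B \<in> sets lebesgue"
  shows "integrable (lebesgue_on A) f"
proof -
  have "set_integrable lebesgue B f"
    using assms by (simp add: set_integrable_def integrable_restrict_space)
  then have "set_integrable lebesgue A f"
    by (rule set_integrable_subset) (use assms in auto)
  then show ?thesis
    using assms by (simp add: set_integrable_def integrable_restrict_space)
qed

lemma smooth_step_affine_DERIV:
  "((\<lambda>r. smooth_step (a * (r - s))) has_real_derivative a * deriv smooth_step (a * (r - s))) (at r)"
proof -
  have "((\<lambda>r. a * (r - s)) has_real_derivative a) (at r)"
    by (auto intro!: derivative_eq_intros)
  from DERIV_chain2[OF smooth_step_DERIV this] show ?thesis by (simp add: mult.commute)
qed

lemma continuous_on_deriv_smooth_step: "continuous_on A (deriv smooth_step)"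
  using bump_algebra_continuous[OF bump_algebra_deriv(1)[OF bump_algebra_smooth_step[of 1 0]]] by simp

text \<open>The kernel is nonnegative, has integral 1 for large \<open>n\<close>, and is
  concentrated on \<open>[s, s + 1/n]\<close>, to the right of \<open>s\<close>. Therefore
  \<open>s = 0\<close> is allowed, while \<open>s < T\<close> leaves room for the whole
  kernel.\<close>

lemma deriv_smooth_step_approximate_identity:
  assumes f: "continuous_on {0..T} f" and s: "0 \<le> s" "s < T"
  shows "(\<lambda>n. integral {0..T} (\<lambda>r. real n * deriv smooth_step (real n * (r - s)) * f r)) \<longlonglongrightarrow> f s"
proof (rule LIMSEQ_I)
  fix e :: real assume "e > 0"
  then have "\<exists>d>0. \<forall>r\<in>{0..T}. dist r s < d \<longrightarrow> dist (f r) (f s) < e / 2"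
    using f[unfolded continuous_on_iff, rule_format, of s "e / 2"] s by simp
  then obtain d where d: "d > 0" "\<And>r. r \<in> {0..T} \<Longrightarrow> dist r s < d \<Longrightarrow> dist (f r) (f s) < e / 2"
    by blast
  \<comment> \<open>The kernel then lies where \<open>f\<close> is within \<open>e / 2\<close> of
    \<open>f s\<close>, and none of its mass is cut off at \<open>T\<close>.\<close>
  obtain N where N: "inverse (real (Suc N)) < min d (T - s)"
    using reals_Archimedean[of "min d (T - s)"] d s by auto
  have "norm (integral {0..T} (\<lambda>r. real n * deriv smooth_step (real n * (r - s)) * f r) - f s) < e"
    if n: "n \<ge> Suc N" for n
  proof -
    let ?D = "\<lambda>r. real n * deriv smooth_step (real n * (r - s))"
    have n0: "real n > 0" using n by simp
    have "inverse (real n) \<le> inverse (real (Suc N))" using n by (intro le_imp_inverse_le) auto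
    then have nd: "1 / real n < d" "1 / real n < T - s" using N by (auto simp: inverse_eq_divide)
    have D: "(?D has_integral smooth_step (real n * (T - s)) - smooth_step (real n * (0 - s))) {0..T}"
    proof (rule fundamental_theorem_of_calculus)
      show "((\<lambda>r. smooth_step (real n * (r - s))) has_vector_derivative ?D r) (at r within {0..T})" for r
        by (rule has_vector_derivative_at_within)
           (simp add: smooth_step_affine_DERIV flip: has_real_derivative_iff_has_vector_derivative)
    qed (use s in simp)
    have "real n * (T - s) \<ge> 1" using nd n0 by (simp add: field_simps)
    moreover have "real n * (0 - s) \<le> 0" using s n0 by (simp add: mult_le_0_iff)
    ultimately have D1: "(?D has_integral 1) {0..T}"
      using D by (simp add: smooth_step_0 smooth_step_1)
    have cD: "continuous_on {0..T} ?D"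
      by (intro continuous_intros continuous_on_compose2[OF continuous_on_deriv_smooth_step[of UNIV]]) auto
    have Df: "(\<lambda>r. ?D r * f r) integrable_on {0..T}"
      by (intro integrable_continuous_interval continuous_intros cD f)
    have I: "((\<lambda>r. ?D r * f r - ?D r * f s) has_integral integral {0..T} (\<lambda>r. ?D r * f r) - 1 * f s) {0..T}"
      by (intro has_integral_diff has_integral_mult_left D1 integrable_integral Df)
    have "norm (integral {0..T} (\<lambda>r. ?D r * f r) - 1 * f s) \<le> integral {0..T} (\<lambda>r. ?D r * (e / 2))"
      unfolding integral_unique[OF I, symmetric]
    proof (rule integral_norm_bound_integral)
      show "(\<lambda>r. ?D r * f r - ?D r * f s) integrable_on {0..T}" using I by blast
      show "(\<lambda>r. ?D r * (e / 2)) integrable_on {0..T}"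
        using has_integral_mult_left[OF D1] by blast
      fix r assume r: "r \<in> {0..T}"
      show "norm (?D r * f r - ?D r * f s) \<le> ?D r * (e / 2)"
      proof (cases "0 \<le> real n * (r - s) \<and> real n * (r - s) \<le> 1")
        case True
        then have "0 \<le> r - s" "r - s \<le> 1 / real n"
          using n0 by (auto simp: zero_le_mult_iff field_simps)
        then have "\<bar>f r - f s\<bar> \<le> e / 2"
          using d(2)[OF r] nd by (auto simp: dist_real_def)
        moreover have "?D r \<ge> 0" using deriv_smooth_step_nonneg n0 by simp
        ultimately have "?D r * \<bar>f r - f s\<bar> \<le> ?D r * (e / 2)" by (intro mult_left_mono)
        then show ?thesis
          by (simp add: abs_mult abs_of_nonneg deriv_smooth_step_nonneg flip: right_diff_distrib)
      next
        case False
        then show ?thesis by (auto simp: deriv_smooth_step_0 not_le)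
      qed
    qed
    also have "\<dots> = e / 2" by (simp only: integral_unique[OF has_integral_mult_left[OF D1]] mult_1_left)
    finally show ?thesis using \<open>e > 0\<close> by simp
  qed
  then show "\<exists>no. \<forall>n\<ge>no. norm (integral {0..T} (\<lambda>r. real n * deriv smooth_step (real n * (r - s)) * f r) - f s) < e"
    by blast
qed

lemma smooth_step_scaled_tendsto:
  "(\<lambda>n. smooth_step (real n * (r - s))) \<longlonglongrightarrow> indicator {s<..} r"
proof (cases "r > s")
  case True
  obtain N where N: "1 / (r - s) \<le> real N" using real_arch_simple by blast
  have "smooth_step (real n * (r - s)) = 1" if "n \<ge> N" for n
  proof -
    have "1 / (r - s) \<le> real n" using N that by linarith
    then show ?thesis using True by (intro smooth_step_1) (simp add: field_simps)
  qed
  then show ?thesis using True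
    by (intro tendsto_eventually) (auto simp: eventually_sequentially)
next
  case False
  then show ?thesis by (simp add: smooth_step_0 mult_le_0_iff)
qed

text \<open>The test function is the difference of two steep steps, at \<open>s\<close> and at
  \<open>t\<close>. It tends to the indicator of \<open>{s<..t}\<close>, which gives the integral of
  \<open>G\<close> by dominated convergence, while its derivative is a difference of two averaging
  kernels and gives \<open>f s - f t\<close>.\<close>

lemma weak_derivative_fundamental_theorem_interior:
  fixes f G :: "real \<Rightarrow> real"
  assumes f: "continuous_on {0..T} f"
    and G: "integrable (lebesgue_on {0..T}) G"
    and weak: "\<And>\<eta>. test_function T \<eta> \<Longrightarrow> (\<integral>t. deriv \<eta> t * f t \<partial>lebesgue_on {0..T})
        = - (\<integral>t. \<eta> t * G t \<partial>lebesgue_on {0..T})"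
    and st: "0 < s" "s \<le> t" "t < T"
  shows "f t - f s = integral {s..t} G"
proof -
  let ?\<eta> = "\<lambda>n r. smooth_step (real n * (r - s)) - smooth_step (real n * (r - t))"
  let ?D = "\<lambda>n s r. real n * deriv smooth_step (real n * (r - s))"
  obtain N where N: "inverse (real (Suc N)) < T - t" using reals_Archimedean[of "T - t"] st by auto
  have ev: "integral {0..T} (\<lambda>r. ?D n s r * f r) - integral {0..T} (\<lambda>r. ?D n t r * f r)
      = - (\<integral>r. ?\<eta> n r * G r \<partial>lebesgue_on {0..T})" if n: "n \<ge> Suc N" for n
  proof -
    have n0: "real n > 0" using n by simp
    have "inverse (real n) \<le> inverse (real (Suc N))" using n by (intro le_imp_inverse_le) auto
    then have nt: "1 / real n < T - t" using N by (auto simp: inverse_eq_divide)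
    have "bump_algebra (\<lambda>r. smooth_step (real n * r + (- real n * s)) + (- 1) * smooth_step (real n * r + (- real n * t)))"
      by (intro bump_algebra.add bump_algebra_cmult bump_algebra_smooth_step)
    then have A: "bump_algebra (?\<eta> n)" by (simp add: algebra_simps)
    have test: "test_function T (?\<eta> n)"
      unfolding test_function_def
    proof (intro conjI allI)
      show "(deriv ^^ k) (?\<eta> n) differentiable_on UNIV" for k
        by (intro bump_algebra_differentiable bump_algebra_funpow_deriv A)
      \<comment> \<open>The support lies in \<open>[s, t + 1/n]\<close>: both steps vanish before
        \<open>s\<close>, and both equal 1 and cancel after \<open>t + 1/n\<close>.\<close>
      show "\<exists>a b. 0 < a \<and> b < T \<and> (\<forall>r. r \<notin> {a..b} \<longrightarrow> ?\<eta> n r = 0)"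
      proof (intro exI conjI allI impI)
        show "0 < s" "t + 1 / real n < T" using st nt by auto
        fix r assume "r \<notin> {s..t + 1 / real n}"
        then consider "r < s" | "r - t > 1 / real n" by force
        then show "?\<eta> n r = 0"
        proof cases
          case 1
          then show ?thesis using st n0 by (simp add: smooth_step_0 mult_le_0_iff)
        next
          case 2
          then have "real n * (r - t) \<ge> 1" using n0 by (simp add: field_simps)
          moreover have "real n * (r - s) \<ge> real n * (r - t)" using st n0 by (intro mult_left_mono) auto
          ultimately show ?thesis by (simp add: smooth_step_1)
        qed
      qed
    qed
    have d: "deriv (?\<eta> n) = (\<lambda>r. ?D n s r - ?D n t r)"
      by (intro ext DERIV_imp_deriv DERIV_diff smooth_step_affine_DERIV)
    have cD: "continuous_on {0..T} (?D n s)" for s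
      by (intro continuous_intros continuous_on_compose2[OF continuous_on_deriv_smooth_step[of UNIV]]) auto
    have c: "continuous_on {0..T} (\<lambda>r. deriv (?\<eta> n) r * f r)"
      unfolding d by (intro continuous_intros cD f)
    have "(\<integral>r. deriv (?\<eta> n) r * f r \<partial>lebesgue_on {0..T}) = integral {0..T} (\<lambda>r. deriv (?\<eta> n) r * f r)"
      by (intro lebesgue_integral_eq_integral continuous_imp_integrable_real c) auto
    also have "\<dots> = integral {0..T} (\<lambda>r. ?D n s r * f r - ?D n t r * f r)"
      by (simp add: d left_diff_distrib)
    also have "\<dots> = integral {0..T} (\<lambda>r. ?D n s r * f r) - integral {0..T} (\<lambda>r. ?D n t r * f r)"
      by (intro integral_diff integrable_continuous_interval continuous_intros cD f)
    finally show ?thesis using weak[OF test] by simp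
  qed
  have "(\<lambda>n. integral {0..T} (\<lambda>r. ?D n s r * f r) - integral {0..T} (\<lambda>r. ?D n t r * f r)) \<longlonglongrightarrow> f s - f t"
    using st by (intro tendsto_diff deriv_smooth_step_approximate_identity f) auto
  then have L1: "(\<lambda>n. - (\<integral>r. ?\<eta> n r * G r \<partial>lebesgue_on {0..T})) \<longlonglongrightarrow> f s - f t"
    by (rule Lim_transform_eventually) (use ev in \<open>auto simp: eventually_sequentially\<close>)
  have "(\<lambda>n. \<integral>r. ?\<eta> n r * G r \<partial>lebesgue_on {0..T})
      \<longlonglongrightarrow> (\<integral>r. (indicator {s<..} r - indicator {t<..} r) * G r \<partial>lebesgue_on {0..T})"
  proof (rule integral_dominated_convergence[where w = "\<lambda>r. \<bar>G r\<bar>"])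
    have G': "G \<in> borel_measurable (lebesgue_on {0..T})" using G by auto
    have "continuous_on {0..T} (?\<eta> n)" for n
      by (intro continuous_intros continuous_on_compose2[OF bump_algebra_continuous[OF bump_algebra_smooth_step[of 1 0], of UNIV, simplified]]) auto
    then show "(\<lambda>r. ?\<eta> n r * G r) \<in> borel_measurable (lebesgue_on {0..T})" for n
      by (intro borel_measurable_times G' continuous_imp_measurable_on_sets_lebesgue) auto
    have "indicator {s<..} \<in> borel_measurable (lebesgue_on {0..T})" for s :: real
      by (intro measurable_restrict_space1 borel_measurable_indicator) auto
    then show "(\<lambda>r. (indicator {s<..} r - indicator {t<..} r) * G r) \<in> borel_measurable (lebesgue_on {0..T})"
      by (intro borel_measurable_times borel_measurable_diff G')
    show "AE r in lebesgue_on {0..T}. (\<lambda>n. ?\<eta> n r * G r)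
        \<longlonglongrightarrow> (indicator {s<..} r - indicator {t<..} r) * G r"
      by (intro AE_I2 tendsto_mult tendsto_diff smooth_step_scaled_tendsto tendsto_const)
    show "AE r in lebesgue_on {0..T}. norm (?\<eta> n r * G r) \<le> \<bar>G r\<bar>" for n
    proof (intro AE_I2)
      fix r
      have "\<bar>?\<eta> n r\<bar> \<le> 1"
        using smooth_step_bounds[of "real n * (r - s)"] smooth_step_bounds[of "real n * (r - t)"] by linarith
      then show "norm (?\<eta> n r * G r) \<le> \<bar>G r\<bar>"
        by (simp add: abs_mult mult_left_le_one_le)
    qed
  qed (use G in auto)
  from LIMSEQ_unique[OF L1 tendsto_minus[OF this]]
  have "f t - f s = (\<integral>r. (indicator {s<..} r - indicator {t<..} r) * G r \<partial>lebesgue_on {0..T})" by simp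
  also have "\<dots> = (\<integral>r. (indicator {0..T} r * (indicator {s<..} r - indicator {t<..} r)) *\<^sub>R G r \<partial>lebesgue)"
    by (simp add: integral_restrict_space mult.assoc)
  also have "(\<lambda>r. (indicator {0..T} r * (indicator {s<..} r - indicator {t<..} r)) *\<^sub>R G r)
      = (\<lambda>r. indicator {s<..t} r *\<^sub>R G r)"
    using st by (auto simp: indicator_def)
  also have "(\<integral>r. indicator {s<..t} r *\<^sub>R G r \<partial>lebesgue) = (\<integral>r. G r \<partial>lebesgue_on {s<..t})"
    by (simp add: integral_restrict_space)
  also have "\<dots> = integral {s<..t} G"
  proof (rule lebesgue_integral_eq_integral)
    show "integrable (lebesgue_on {s<..t}) G"
      using st by (intro integrable_lebesgue_on_subset[OF G]) auto
  qed auto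
  also have "\<dots> = integral {s..t} G"
    by (rule integral_subset_negligible)
       (auto intro: negligible_subset[of "{s}"])
  finally show ?thesis .
qed

text \<open>By the interior version, \<open>f\<close> minus the primitive of \<open>G\<close> is
  constant on the open interval; continuity extends this to both endpoints, where no test function
  is supported.\<close>

lemma weak_derivative_fundamental_theorem:
  fixes f G :: "real \<Rightarrow> real"
  assumes T: "T > 0" and f: "continuous_on {0..T} f"
    and G: "integrable (lebesgue_on {0..T}) G"
    and weak: "\<And>\<eta>. test_function T \<eta> \<Longrightarrow> (\<integral>t. deriv \<eta> t * f t \<partial>lebesgue_on {0..T})
        = - (\<integral>t. \<eta> t * G t \<partial>lebesgue_on {0..T})"
    and st: "0 \<le> s" "s \<le> t" "t \<le> T"
  shows "f t - f s = integral {s..t} G"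
proof -
  have GI: "G integrable_on {0..T}" using G by (auto intro: integrable_on_lebesgue_on)
  define k where "k t = f t - integral {0..t} G" for t
  have split: "integral {0..t} G - integral {0..s} G = integral {s..t} G" if "0 \<le> s" "s \<le> t" "t \<le> T" for s t
    using Henstock_Kurzweil_Integration.integral_combine[OF that(1,2), of G]
      integrable_on_subinterval[OF GI, of 0 t] that by simp
  have ck: "continuous_on {0..T} k"
    unfolding k_def by (intro continuous_intros f indefinite_integral_continuous_1 GI)
  have le: "k t = k s" if "0 < s" "s \<le> t" "t < T" for s t
    using weak_derivative_fundamental_theorem_interior[OF f G weak that] split[of s t] that
    by (simp add: k_def)
  have c: "k t = k (T / 2)" if "t \<in> {0<..<T}" for t
  proof (cases "t \<le> T / 2")
    case True
    then show ?thesis using le[of t "T / 2"] that T by simp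
  next
    case False
    then show ?thesis using le[of "T / 2" t] that T by simp
  qed
  have "k t = k (T / 2)" if "t \<in> {0..T}" for t
  proof (rule continuous_constant_on_closure[of "{0<..<T}" k])
    show "continuous_on (closure {0<..<T}) k" "t \<in> closure {0<..<T}"
      using ck that T by auto
  qed (rule c)
  from this[of t] this[of s] have "k t = k s" using st by fastforce
  then show ?thesis using split[OF st] by (simp add: k_def)
qed

section \<open>Lebesgue points and Fatou's lemma\<close>

text \<open>\<open>integrable_ccontinuous_explicit\<close> differentiates averages over intervals to
  the right of a point on the whole line. Extending by zero and reflecting turns it into the
  statement about left averages that backward difference quotients call for.\<close>

lemma lebesgue_differentiation_left:
  fixes f :: "real \<Rightarrow> real"
  assumes f: "f integrable_on {c..b}"
  shows "AE t in lebesgue. t \<in> {c<..b} \<longrightarrow> ((\<lambda>h. integral {t - h..t} f / h) \<longlongrightarrow> f t) (at_right 0)"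
proof -
  define k where "k r = (if r \<in> {c..b} then f r else 0)" for r
  have "k integrable_on UNIV" using f unfolding k_def integrable_restrict_UNIV .
  then have kI: "k integrable_on {x..y}" for x y
    using integrable_on_subinterval[of k UNIV x y] by simp
  have "(\<lambda>x. k (- x)) integrable_on cbox x y" for x y
    using Henstock_Kurzweil_Integration.integrable_reflect_real[where f = k and a = "- y" and b = "- x"] kI[of "- y" "- x"] by simp
  then obtain N where N: "negligible N" and
    lim: "\<And>x e. x \<notin> N \<Longrightarrow> 0 < e \<Longrightarrow> \<exists>d>0. \<forall>h. 0 < h \<and> h < d \<longrightarrow>
        norm (integral (cbox x (x + h *\<^sub>R One)) (\<lambda>x. k (- x)) /\<^sub>R h ^ DIM(real) - k (- x)) < e"
    by (rule integrable_ccontinuous_explicit) blast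
  have "negligible (uminus ` N)"
    by (rule negligible_differentiable_image_negligible[OF _ N]) (auto intro!: differentiable_on_minus differentiable_on_ident)
  then have "uminus ` N \<in> null_sets lebesgue"
    by (simp add: negligible_iff_null_sets)
  then have "AE t in lebesgue. t \<notin> uminus ` N" by (rule AE_not_in)
  then show ?thesis
  proof eventually_elim
    case (elim t)
    show ?case
    proof
      assume t: "t \<in> {c<..b}"
      have tN: "- t \<notin> N" using elim by force
      show "((\<lambda>h. integral {t - h..t} f / h) \<longlongrightarrow> f t) (at_right 0)"
      proof (rule tendstoI)
        fix e :: real assume "e > 0"
        then obtain d where d: "d > 0" "\<And>h. 0 < h \<Longrightarrow> h < d \<Longrightarrow>
            norm (integral (cbox (- t) (- t + h *\<^sub>R One)) (\<lambda>x. k (- x)) /\<^sub>R h ^ DIM(real) - k (- (- t))) < e"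
          using lim[OF tN] by blast
        \<comment> \<open>\<open>h < t - c\<close> keeps the averaging interval inside
          \<open>{c..b}\<close>, where the extension by zero agrees with \<open>f\<close>.\<close>
        have "dist (integral {t - h..t} f / h) (f t) < e" if h: "0 < h" "h < min d (t - c)" for h
        proof -
          have "integral {- t..- t + h} (\<lambda>x. k (- x)) = integral {t - h..t} k"
            using Henstock_Kurzweil_Integration.integral_reflect_real[where f = k and a = "t - h" and b = t]
            by simp
          also have "\<dots> = integral {t - h..t} f"
            by (rule Henstock_Kurzweil_Integration.integral_cong) (use t h in \<open>auto simp: k_def\<close>)
          finally show ?thesis
            using d(2)[of h] h t by (simp add: k_def dist_real_def divide_inverse mult.commute)
        qed
        moreover have "min d (t - c) > 0" using d t by simp
        ultimately show "\<forall>\<^sub>F h in at_right 0. dist (integral {t - h..t} f / h) (f t) < e"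
          unfolding eventually_at_right_field by blast
      qed
    qed
  qed
qed

text \<open>With a primitive \<open>K\<close> of \<open>k\<close>, the integral is the backward
  difference quotient of \<open>K\<close> at \<open>b\<close> minus the one at \<open>a\<close>, and
  each converges to a value of \<open>k\<close>.\<close>

lemma integral_difference_quotient_tendsto:
  fixes k :: "real \<Rightarrow> real"
  assumes k: "continuous_on {a - 1..b} k" and ab: "a \<le> b"
    and h: "\<And>n. 0 < h n" "\<And>n. h n < 1" "h \<longlonglongrightarrow> 0"
  shows "(\<lambda>n. integral {a..b} (\<lambda>t. (k t - k (t - h n)) / h n)) \<longlonglongrightarrow> k b - k a"
proof -
  define K where "K x = integral {a - 1..x} k" for x
  have K: "(K has_real_derivative k x) (at x within {a - 1..b})" if "x \<in> {a - 1..b}" for x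
    unfolding K_def using integral_has_real_derivative[OF k that] .
  have I: "integral {a..b} (\<lambda>t. (k t - k (t - h n)) / h n)
      = (K b - K (b - h n)) / h n - (K a - K (a - h n)) / h n" for n
  proof (rule integral_unique, rule fundamental_theorem_of_calculus[OF ab])
    fix x assume x: "x \<in> {a..b}"
    have "(K has_real_derivative k x) (at x within {a..b})"
      using K[of x] x by (auto intro: DERIV_subset)
    moreover have "((\<lambda>x. K (x - h n)) has_real_derivative k (x - h n) * 1) (at x within {a..b})"
    proof (rule DERIV_image_chain[of K _ "\<lambda>x. x - h n", unfolded o_def])
      show "(K has_real_derivative k (x - h n)) (at (x - h n) within (\<lambda>x. x - h n) ` {a..b})"
        using x h(1,2)[of n] by (intro DERIV_subset[OF K]) auto
    qed (auto intro!: derivative_eq_intros)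
    ultimately have "((\<lambda>x. (K x - K (x - h n)) / h n) has_real_derivative (k x - k (x - h n) * 1) / h n)
        (at x within {a..b})"
      by (intro DERIV_cdivide DERIV_diff)
    then show "((\<lambda>x. (K x - K (x - h n)) / h n) has_vector_derivative (k x - k (x - h n)) / h n)
        (at x within {a..b})"
      by (simp add: has_real_derivative_iff_has_vector_derivative)
  qed
  have L: "(\<lambda>n. (K x - K (x - h n)) / h n) \<longlonglongrightarrow> k x" if "x \<in> {a..b}" for x
  proof -
    have "((\<lambda>y. (K y - K x) / (y - x)) \<longlongrightarrow> k x) (at x within {a - 1..b})"
      using K[of x] that by (auto simp: has_field_derivative_iff)
    moreover have "filterlim (\<lambda>n. x - h n) (at x within {a - 1..b}) sequentially"
      unfolding filterlim_at
    proof
      show "(\<lambda>n. x - h n) \<longlonglongrightarrow> x" using tendsto_diff[OF tendsto_const h(3), of x] by simp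
      show "\<forall>\<^sub>F n in sequentially. x - h n \<in> {a - 1..b} \<and> x - h n \<noteq> x"
        using h(1,2) that by (intro always_eventually allI) (smt (verit) atLeastAtMost_iff)
    qed
    ultimately have "(\<lambda>n. (K (x - h n) - K x) / (x - h n - x)) \<longlonglongrightarrow> k x"
      by (rule filterlim_compose)
    moreover have "(K (x - h n) - K x) / (x - h n - x) = (K x - K (x - h n)) / h n" for n
      using h(1)[of n] by (simp add: field_simps)
    ultimately show ?thesis by simp
  qed
  show ?thesis
    unfolding I using ab by (intro tendsto_diff L) auto
qed

text \<open>Stated with upper bounds \<open>c n\<close> because the integrals themselves are not
  known to converge; integrability of the limit is part of the conclusion.\<close>

lemma Fatou_real:
  fixes f :: "nat \<Rightarrow> 'a \<Rightarrow> real"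
  assumes f: "\<And>n. integrable M (f n)" "\<And>n. AE x in M. 0 \<le> f n x"
    and F: "F \<in> borel_measurable M" "AE x in M. (\<lambda>n. f n x) \<longlonglongrightarrow> F x"
    and c: "\<And>n. integral\<^sup>L M (f n) \<le> c n" "c \<longlonglongrightarrow> C"
  shows "integrable M F" "integral\<^sup>L M F \<le> C"
proof -
  have nn: "AE x in M. 0 \<le> F x"
  proof -
    have "AE x in M. \<forall>n. 0 \<le> f n x" using f(2) by (simp add: AE_all_countable)
    then show ?thesis
      using F(2) by eventually_elim (auto intro: LIMSEQ_le_const)
  qed
  have "0 \<le> integral\<^sup>L M (f n)" for n using f(2) by (rule integral_nonneg_AE)
  then have c0: "c n \<ge> 0" for n using c(1)[of n] by (meson order_trans)
  have C0: "C \<ge> 0" using c(2) c0 by (intro LIMSEQ_le_const) auto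
  have "(\<integral>\<^sup>+ x. ennreal (F x) \<partial>M) = (\<integral>\<^sup>+ x. liminf (\<lambda>n. ennreal (f n x)) \<partial>M)"
  proof (rule nn_integral_cong_AE)
    show "AE x in M. ennreal (F x) = liminf (\<lambda>n. ennreal (f n x))"
      using F(2)
    proof eventually_elim
      case (elim x)
      then have "(\<lambda>n. ennreal (f n x)) \<longlonglongrightarrow> ennreal (F x)" by simp
      then show ?case by (simp add: lim_imp_Liminf)
    qed
  qed
  also have "\<dots> \<le> liminf (\<lambda>n. \<integral>\<^sup>+ x. ennreal (f n x) \<partial>M)"
    using f(1) by (intro nn_integral_liminf) auto
  also have "\<dots> \<le> liminf (\<lambda>n. ennreal (c n))"
  proof (intro Liminf_mono always_eventually allI)
    fix n
    have "(\<integral>\<^sup>+ x. ennreal (f n x) \<partial>M) = ennreal (integral\<^sup>L M (f n))"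
      by (rule nn_integral_eq_integral[OF f(1,2)])
    then show "(\<integral>\<^sup>+ x. ennreal (f n x) \<partial>M) \<le> ennreal (c n)"
      using c(1) by (simp add: ennreal_leI)
  qed
  also have "\<dots> = ennreal C"
    using c(2) by (intro lim_imp_Liminf) auto
  finally have le: "(\<integral>\<^sup>+ x. ennreal (F x) \<partial>M) \<le> ennreal C" .
  then show I: "integrable M F"
    using nn F(1) by (intro integrableI_nonneg) (auto simp: top_unique less_top[symmetric])
  show "integral\<^sup>L M F \<le> C"
    using le C0 nn_integral_eq_integral[OF I nn] by simp
qed

section \<open>The energy inequality\<close>

text \<open>The set of good times \<open>t\<close> must not depend on the vector, since
  \<open>x\<close> will be chosen as a function of \<open>t\<close>. Convergence is assumed on
  \<open>D\<close> only; replacing \<open>x\<close> by a nearby \<open>d\<close> costs at most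
  averages of \<open>m\<close> times the distance, and these averages converge too.\<close>

lemma average_tendsto_of_dense:
  fixes g :: "real \<Rightarrow> 'h::real_vector \<Rightarrow> real" and m :: "real \<Rightarrow> real"
  assumes V: "banach_sub V" and D: "D \<subseteq> carr V"
    and dense: "\<And>x e. x \<in> carr V \<Longrightarrow> 0 < e \<Longrightarrow> \<exists>d\<in>D. nrm V (x - d) < e"
    and t: "c < t" "t \<le> b"
    and gI: "\<And>w. w \<in> carr V \<Longrightarrow> (\<lambda>r. g r w) integrable_on {c..b}"
    and lin: "\<And>r v w. v \<in> carr V \<Longrightarrow> w \<in> carr V \<Longrightarrow> g r (v - w) = g r v - g r w"
    and bound: "\<And>r w. w \<in> carr V \<Longrightarrow> \<bar>g r w\<bar> \<le> m r * nrm V w"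
    and m: "0 \<le> m t" "m integrable_on {c..b}"
    and lim_g: "\<And>d. d \<in> D \<Longrightarrow> ((\<lambda>h. integral {t - h..t} (\<lambda>r. g r d) / h) \<longlongrightarrow> g t d) (at_right 0)"
    and lim_m: "((\<lambda>h. integral {t - h..t} m / h) \<longlongrightarrow> m t) (at_right 0)"
    and x: "x \<in> carr V"
  shows "((\<lambda>h. integral {t - h..t} (\<lambda>r. g r x) / h) \<longlongrightarrow> g t x) (at_right 0)"
proof (rule tendstoI)
  fix e :: real assume e: "e > 0"
  \<comment> \<open>\<open>m t + 1\<close> bounds the averages of \<open>m\<close> for small
    \<open>h\<close>, and another \<open>m t\<close> bounds the functional at time \<open>t\<close>
    itself.\<close>
  define N where "N = 2 * m t + 1"
  have N: "N > 0" using m(1) by (simp add: N_def)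
  obtain d where d: "d \<in> D" "nrm V (x - d) < e / 2 / N"
    using dense[OF x, of "e / 2 / N"] e N by auto
  define y where "y = x - d"
  have dV: "d \<in> carr V" and yV: "y \<in> carr V"
    using d D x V by (auto simp: y_def subspace_diff banach_sub_subspace)
  have y: "0 \<le> nrm V y" "nrm V y * N < e / 2"
    using banach_sub_nrm_nonneg[OF V yV] d(2) N by (auto simp: y_def field_simps)
  have "\<forall>\<^sub>F h in at_right 0. (h::real) > 0" by (rule eventually_at_right_less)
  moreover have "\<forall>\<^sub>F h in at_right 0. h < t - c"
    using t by (intro order_tendstoD(2)[OF tendsto_ident_at]) simp
  moreover have "\<forall>\<^sub>F h in at_right 0. dist (integral {t - h..t} (\<lambda>r. g r d) / h) (g t d) < e / 2"
    by (rule tendstoD[OF lim_g[OF d(1)]]) (use e in simp)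
  moreover have "\<forall>\<^sub>F h in at_right 0. integral {t - h..t} m / h < m t + 1"
    using order_tendstoD(2)[OF lim_m] by simp
  ultimately show "\<forall>\<^sub>F h in at_right 0. dist (integral {t - h..t} (\<lambda>r. g r x) / h) (g t x) < e"
  proof eventually_elim
    case (elim h)
    have subI: "k integrable_on {t - h..t}" if "k integrable_on {c..b}" for k :: "real \<Rightarrow> real"
      by (rule integrable_on_subinterval[OF that]) (use elim t in auto)
    have "\<bar>integral {t - h..t} (\<lambda>r. g r y)\<bar> \<le> integral {t - h..t} (\<lambda>r. m r * nrm V y)"
      unfolding real_norm_def[symmetric] using bound[OF yV]
      by (intro integral_norm_bound_integral integrable_on_mult_left subI gI yV m) auto
    then have "\<bar>integral {t - h..t} (\<lambda>r. g r y) / h\<bar> \<le> integral {t - h..t} m / h * nrm V y"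
      using elim(1) by (simp add: divide_right_mono)
    also have "\<dots> \<le> (m t + 1) * nrm V y"
      using elim(4) y by (intro mult_right_mono) auto
    finally have 1: "\<bar>integral {t - h..t} (\<lambda>r. g r y) / h\<bar> \<le> (m t + 1) * nrm V y" .
    have "(\<lambda>r. g r y) = (\<lambda>r. g r x - g r d)"
      using lin[OF x dV] by (simp add: y_def)
    then have 2: "integral {t - h..t} (\<lambda>r. g r y) / h
        = integral {t - h..t} (\<lambda>r. g r x) / h - integral {t - h..t} (\<lambda>r. g r d) / h"
      using integral_diff[OF subI[OF gI[OF x]] subI[OF gI[OF dV]]] by (simp add: diff_divide_distrib)
    have 3: "g t y = g t x - g t d" using lin[OF x dV] by (simp add: y_def)
    have "\<bar>integral {t - h..t} (\<lambda>r. g r x) / h - g t x\<bar>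
        \<le> \<bar>integral {t - h..t} (\<lambda>r. g r y) / h\<bar> + \<bar>integral {t - h..t} (\<lambda>r. g r d) / h - g t d\<bar> + \<bar>g t y\<bar>"
      unfolding 2 3 by linarith
    also have "\<dots> < (m t + 1) * nrm V y + e / 2 + m t * nrm V y"
      using 1 elim(3) bound[OF yV, of t] by (simp add: dist_real_def)
    also have "\<dots> = nrm V y * N + e / 2" by (simp add: N_def algebra_simps)
    also have "\<dots> < e" using y by simp
    finally show ?case by (simp add: dist_real_def)
  qed
qed

text \<open>
  Only the difference quotients of \<open>\<phi>\<close> are used: \<open>q(t) - q(t-h) \<le> 2 \<langle>\<phi>(t) - \<phi>(t-h), \<phi>(t)\<rangle>\<close> for
  \<open>q = \<parallel>\<phi>\<parallel>\<^sup>2\<close>, and the right-hand side divided by \<open>h\<close> tends to \<open>2 g(t)(\<phi>(t))\<close> at almost every \<open>t\<close>.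
  Fatou's lemma passes to the limit, after adding \<open>h\<^sup>-\<^sup>1 \<integral> m\<^sup>2\<close> (over \<open>[t-h,t]\<close>) and \<open>p\<^sup>2\<close> to make
  the integrands nonnegative. The bound \<open>a - 1\<close> leaves room for the backward shift \<open>h < 1\<close>.
\<close>

lemma energy_inequality:
  fixes \<phi> :: "real \<Rightarrow> 'h::real_inner" and g :: "real \<Rightarrow> 'h \<Rightarrow> real" and m p :: "real \<Rightarrow> real"
  assumes V: "banach_sub V"
    and D: "countable D" "D \<subseteq> carr V"
    and dense: "\<And>x e. x \<in> carr V \<Longrightarrow> 0 < e \<Longrightarrow> \<exists>d\<in>D. nrm V (x - d) < e"
    and ab: "a \<le> b"
    and cont: "continuous_on {a - 1..b} \<phi>"
    and gI: "\<And>w. w \<in> carr V \<Longrightarrow> (\<lambda>r. g r w) integrable_on {a - 1..b}"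
    and ftc: "\<And>w s t. w \<in> carr V \<Longrightarrow> a - 1 \<le> s \<Longrightarrow> s \<le> t \<Longrightarrow> t \<le> b \<Longrightarrow>
        inner (\<phi> t - \<phi> s) w = integral {s..t} (\<lambda>r. g r w)"
    and lin: "\<And>r v w. v \<in> carr V \<Longrightarrow> w \<in> carr V \<Longrightarrow> g r (v - w) = g r v - g r w"
    and bound: "\<And>r w. w \<in> carr V \<Longrightarrow> \<bar>g r w\<bar> \<le> m r * nrm V w"
    and m: "\<And>r. 0 \<le> m r" "m integrable_on {a - 1..b}" "(\<lambda>r. (m r)\<^sup>2) integrable_on {a - 1..b}"
    and p: "AE t in lebesgue_on {a..b}. \<phi> t \<in> carr V \<and> p t = nrm V (\<phi> t)"
      "integrable (lebesgue_on {a..b}) (\<lambda>t. (p t)\<^sup>2)"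
  obtains f where "integrable (lebesgue_on {a..b}) f"
    "AE t in lebesgue_on {a..b}. f t = g t (\<phi> t)"
    "(norm (\<phi> b))\<^sup>2 - (norm (\<phi> a))\<^sup>2 \<le> 2 * (\<integral>t. f t \<partial>lebesgue_on {a..b})"
proof -
  let ?M = "lebesgue_on {a..b}"
  \<comment> \<open>Two successors keep \<open>h n\<close> strictly below 1 from
    \<open>n = 0\<close> on.\<close>
  define h where "h n = inverse (real (Suc (Suc n)))" for n
  have h: "0 < h n" "h n < 1" "h \<longlonglongrightarrow> 0" for n
    unfolding h_def using LIMSEQ_Suc[OF LIMSEQ_inverse_real_of_nat] by (auto simp: field_simps)
  have h_right: "filterlim h (at_right 0) sequentially"
    using h(1,3) by (auto simp: filterlim_at less_imp_neq[symmetric] intro!: always_eventually)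
  \<comment> \<open>Through the primitive, the average of \<open>m\<^sup>2\<close> becomes a
    difference quotient of a continuous function, so the limit of its integral comes from
    \<open>integral_difference_quotient_tendsto\<close>.\<close>
  define \<Gamma> where "\<Gamma> t = integral {a - 1..t} (\<lambda>r. (m r)\<^sup>2)" for t
  have c\<Gamma>: "continuous_on {a - 1..b} \<Gamma>"
    unfolding \<Gamma>_def by (rule indefinite_integral_continuous_1[OF m(3)])
  have \<Gamma>_diff: "\<Gamma> t - \<Gamma> s = integral {s..t} (\<lambda>r. (m r)\<^sup>2)" if "a - 1 \<le> s" "s \<le> t" "t \<le> b" for s t
    using Henstock_Kurzweil_Integration.integral_combine[OF that(1,2), of "\<lambda>r. (m r)\<^sup>2"]
      integrable_on_subinterval[OF m(3), of "a - 1" t] that by (simp add: \<Gamma>_def)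
  define q where "q t = (norm (\<phi> t))\<^sup>2" for t
  have cq: "continuous_on {a - 1..b} q"
    unfolding q_def by (intro continuous_intros cont)
  define B where "B n t = inner (\<phi> t - \<phi> (t - h n)) (\<phi> t) / h n" for n t
  have shift: "continuous_on {a..b} (\<lambda>t. k (t - h n))" if "continuous_on {a - 1..b} k"
    for k :: "real \<Rightarrow> 'b::real_normed_vector" and n
    by (rule continuous_on_compose2[OF that]) (use h(1,2)[of n] in \<open>auto intro!: continuous_intros\<close>)
  have sub: "continuous_on {a..b} k" if "continuous_on {a - 1..b} k" for k :: "real \<Rightarrow> 'b::real_normed_vector"
    by (rule continuous_on_subset[OF that]) auto
  have cB: "continuous_on {a..b} (B n)" for n
    unfolding B_def using h(1)[of n] by (intro continuous_intros shift sub cont) auto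
  have B_integral: "B n t = integral {t - h n..t} (\<lambda>r. g r (\<phi> t)) / h n"
    if "t \<in> {a..b}" "\<phi> t \<in> carr V" for n t
    using ftc[OF that(2), of "t - h n" t] that h(1,2)[of n] by (simp add: B_def)

  define E where "E n t = (\<Gamma> t - \<Gamma> (t - h n)) / h n + (p t)\<^sup>2 - 2 * B n t" for n t
  have E_nonneg: "0 \<le> E n t" if t: "t \<in> {a..b}" "\<phi> t \<in> carr V" "p t = nrm V (\<phi> t)" for n t
  proof -
    have hn: "0 < h n" "h n < 1" by (rule h)+
    have subI: "k integrable_on {t - h n..t}" if "k integrable_on {a - 1..b}" for k :: "real \<Rightarrow> real"
      by (rule integrable_on_subinterval[OF that]) (use hn t in auto)
    have "2 * integral {t - h n..t} (\<lambda>r. g r (\<phi> t)) = integral {t - h n..t} (\<lambda>r. 2 * g r (\<phi> t))"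
      by simp
    \<comment> \<open>\<open>2 g \<le> 2 m p \<le> m\<^sup>2 + p\<^sup>2\<close>, with
      \<open>p\<close> frozen at time \<open>t\<close>; the two terms added in \<open>E\<close>
      compensate exactly this.\<close>
    also have "\<dots> \<le> integral {t - h n..t} (\<lambda>r. (m r)\<^sup>2 + (p t)\<^sup>2)"
    proof (rule integral_le)
      show "2 * g r (\<phi> t) \<le> (m r)\<^sup>2 + (p t)\<^sup>2" for r
        using bound[OF t(2), of r] sum_squares_bound[of "m r" "p t"] t(3) by (auto simp: abs_le_iff)
      show "(\<lambda>r. 2 * g r (\<phi> t)) integrable_on {t - h n..t}"
        using integrable_cmul[OF subI[OF gI[OF t(2)]], of 2] by simp
      show "(\<lambda>r. (m r)\<^sup>2 + (p t)\<^sup>2) integrable_on {t - h n..t}"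
        by (rule integrable_add[OF subI[OF m(3)] integrable_const_ivl])
    qed
    also have "\<dots> = (\<Gamma> t - \<Gamma> (t - h n)) + h n * (p t)\<^sup>2"
      using hn t by (subst integral_add) (auto intro!: subI m integrable_const_ivl simp: \<Gamma>_diff)
    finally have "2 * B n t \<le> ((\<Gamma> t - \<Gamma> (t - h n)) + h n * (p t)\<^sup>2) / h n"
      using hn B_integral[OF t(1,2), of n] by (simp add: divide_right_mono)
    then show ?thesis
      using hn by (simp add: E_def add_divide_distrib)
  qed

  have "AE t in lebesgue. \<forall>d\<in>D. t \<in> {a - 1<..b} \<longrightarrow>
      ((\<lambda>h. integral {t - h..t} (\<lambda>r. g r d) / h) \<longlongrightarrow> g t d) (at_right 0)"
    using D gI by (intro AE_ball_countable' lebesgue_differentiation_left) auto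
  moreover have "AE t in lebesgue. t \<in> {a - 1<..b} \<longrightarrow> ((\<lambda>h. integral {t - h..t} m / h) \<longlongrightarrow> m t) (at_right 0)"
    by (rule lebesgue_differentiation_left[OF m(2)])
  moreover have "AE t in lebesgue. t \<in> {a - 1<..b} \<longrightarrow>
      ((\<lambda>h. integral {t - h..t} (\<lambda>r. (m r)\<^sup>2) / h) \<longlongrightarrow> (m t)\<^sup>2) (at_right 0)"
    by (rule lebesgue_differentiation_left[OF m(3)])
  moreover have "AE t in lebesgue. t \<in> {a..b} \<longrightarrow> \<phi> t \<in> carr V \<and> p t = nrm V (\<phi> t)"
    using p(1) by (subst (asm) AE_restrict_space_iff) auto
  ultimately have "AE t in lebesgue. t \<in> {a..b} \<longrightarrow>
      (\<lambda>n. B n t) \<longlonglongrightarrow> g t (\<phi> t) \<and> (\<lambda>n. E n t) \<longlonglongrightarrow> (m t)\<^sup>2 + (p t)\<^sup>2 - 2 * g t (\<phi> t)"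
  proof eventually_elim
    case (elim t)
    show ?case
    proof
      assume t: "t \<in> {a..b}"
      then have t': "a - 1 < t" "t \<le> b" by auto
      have \<phi>t: "\<phi> t \<in> carr V" "p t = nrm V (\<phi> t)" using elim(4) t by auto
      have "((\<lambda>h. integral {t - h..t} (\<lambda>r. g r (\<phi> t)) / h) \<longlongrightarrow> g t (\<phi> t)) (at_right 0)"
        using elim t' by (intro average_tendsto_of_dense[OF V D(2) dense t' gI lin bound m(1,2) _ _ \<phi>t(1)]) auto
      from filterlim_compose[OF this h_right] have BL: "(\<lambda>n. B n t) \<longlonglongrightarrow> g t (\<phi> t)"
        by (simp add: B_integral[OF t \<phi>t(1)])
      have "((\<lambda>h. integral {t - h..t} (\<lambda>r. (m r)\<^sup>2) / h) \<longlongrightarrow> (m t)\<^sup>2) (at_right 0)"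
        using elim t' by simp
      from filterlim_compose[OF this h_right]
      have "(\<lambda>n. integral {t - h n..t} (\<lambda>r. (m r)\<^sup>2) / h n) \<longlonglongrightarrow> (m t)\<^sup>2" .
      moreover have "\<Gamma> t - \<Gamma> (t - h n) = integral {t - h n..t} (\<lambda>r. (m r)\<^sup>2)" for n
        using t h(1,2)[of n] by (intro \<Gamma>_diff) auto
      ultimately have "(\<lambda>n. (\<Gamma> t - \<Gamma> (t - h n)) / h n) \<longlonglongrightarrow> (m t)\<^sup>2"
        by simp
      then have "(\<lambda>n. E n t) \<longlonglongrightarrow> (m t)\<^sup>2 + (p t)\<^sup>2 - 2 * g t (\<phi> t)"
        unfolding E_def by (intro tendsto_intros BL)
      with BL show "(\<lambda>n. B n t) \<longlonglongrightarrow> g t (\<phi> t) \<and> (\<lambda>n. E n t) \<longlonglongrightarrow> (m t)\<^sup>2 + (p t)\<^sup>2 - 2 * g t (\<phi> t)"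
        by blast
    qed
  qed
  then have lims: "AE t in ?M. (\<lambda>n. B n t) \<longlonglongrightarrow> g t (\<phi> t) \<and>
      (\<lambda>n. E n t) \<longlonglongrightarrow> (m t)\<^sup>2 + (p t)\<^sup>2 - 2 * g t (\<phi> t)"
    by (subst AE_restrict_space_iff) auto

  have CI: "integrable ?M k" if "continuous_on {a..b} k" for k :: "real \<Rightarrow> real"
    by (rule continuous_imp_integrable_real[OF that])
  have CE: "(\<integral>t. k t \<partial>?M) = integral {a..b} k" if "continuous_on {a..b} k" for k :: "real \<Rightarrow> real"
    by (rule lebesgue_integral_eq_integral[OF CI[OF that]]) simp
  have m2: "integrable ?M (\<lambda>r. (m r)\<^sup>2)"
  proof -
    have "(\<lambda>r. (m r)\<^sup>2) integrable_on {a..b}"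
      by (rule integrable_on_subinterval[OF m(3)]) auto
    then have "(\<lambda>r. (m r)\<^sup>2) absolutely_integrable_on {a..b}"
      by (intro nonnegative_absolutely_integrable_1) auto
    then show ?thesis by (simp add: set_integrable_def integrable_restrict_space)
  qed
  \<comment> \<open>The map sending \<open>t\<close> to \<open>g t (\<phi> t)\<close> is not known
    to be measurable, since only pairings with fixed vectors are controlled. As a pointwise limit of
    continuous functions, \<open>f\<close> is measurable, and it agrees with that map almost
    everywhere.\<close>
  define f where "f t = lim (\<lambda>n. B n t)" for t
  have f: "AE t in ?M. f t = g t (\<phi> t)"
    using lims by eventually_elim (auto simp: f_def limI)
  have fM: "f \<in> borel_measurable ?M"
    unfolding f_def using CI[OF cB] by (intro borel_measurable_lim_metric) auto
  define F where "F t = (m t)\<^sup>2 + (p t)\<^sup>2 - 2 * f t" for t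
  have FM: "F \<in> borel_measurable ?M"
    unfolding F_def using m2 p(2) fM by (intro borel_measurable_add borel_measurable_diff borel_measurable_times) auto
  have EI: "integrable ?M (E n)" for n
    unfolding E_def using h(1)[of n]
    by (intro Bochner_Integration.integrable_add Bochner_Integration.integrable_diff integrable_mult_right p CI cB
        continuous_intros shift sub c\<Gamma>) auto
  let ?c = "\<lambda>n. integral {a..b} (\<lambda>t. (\<Gamma> t - \<Gamma> (t - h n)) / h n) + (\<integral>t. (p t)\<^sup>2 \<partial>?M)
      - integral {a..b} (\<lambda>t. (q t - q (t - h n)) / h n)"
  have Ec: "(\<integral>t. E n t \<partial>?M) \<le> ?c n" for n
  proof -
    have hn: "h n > 0" by (rule h)
    have c1: "continuous_on {a..b} (\<lambda>t. (\<Gamma> t - \<Gamma> (t - h n)) / h n)"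
      using hn by (intro continuous_intros shift sub c\<Gamma>) auto
    have c2: "continuous_on {a..b} (\<lambda>t. (q t - q (t - h n)) / h n)"
      using hn by (intro continuous_intros shift sub cq) auto
    have "(\<integral>t. E n t \<partial>?M) \<le> (\<integral>t. (\<Gamma> t - \<Gamma> (t - h n)) / h n + (p t)\<^sup>2 - (q t - q (t - h n)) / h n \<partial>?M)"
    proof (rule integral_mono[OF EI])
      fix t
      \<comment> \<open>Polarization; the square of the increment has the sign that allows it to be
        dropped.\<close>
      have "q t - q (t - h n) = 2 * inner (\<phi> t - \<phi> (t - h n)) (\<phi> t) - (norm (\<phi> t - \<phi> (t - h n)))\<^sup>2"
        by (simp add: q_def power2_norm_eq_inner inner_diff_left inner_diff_right inner_commute)
      then have "q t - q (t - h n) \<le> 2 * inner (\<phi> t - \<phi> (t - h n)) (\<phi> t)" by simp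
      then have "(q t - q (t - h n)) / h n \<le> 2 * B n t"
        using hn by (simp add: B_def divide_right_mono)
      then show "E n t \<le> (\<Gamma> t - \<Gamma> (t - h n)) / h n + (p t)\<^sup>2 - (q t - q (t - h n)) / h n"
        by (simp add: E_def)
    qed (intro Bochner_Integration.integrable_add Bochner_Integration.integrable_diff p CI c1 c2)
    also have "\<dots> = ?c n"
      by (simp only: Bochner_Integration.integral_add Bochner_Integration.integral_diff
          Bochner_Integration.integrable_add p(2) CI[OF c1] CI[OF c2] CE[OF c1] CE[OF c2])
    finally show ?thesis .
  qed
  have cL: "?c \<longlonglongrightarrow> (\<Gamma> b - \<Gamma> a) + (\<integral>t. (p t)\<^sup>2 \<partial>?M) - (q b - q a)"
    by (intro tendsto_intros integral_difference_quotient_tendsto c\<Gamma> cq ab h)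
  have E0: "AE t in ?M. 0 \<le> E n t" for n
    using p(1) AE_space by eventually_elim (auto intro!: E_nonneg)
  have EF: "AE t in ?M. (\<lambda>n. E n t) \<longlonglongrightarrow> F t"
    using lims f by eventually_elim (simp add: F_def)
  note Fatou = Fatou_real[OF EI E0 FM EF Ec cL]
  \<comment> \<open>Fatou's lemma gives integrability of \<open>F\<close>, and that of
    \<open>f\<close> is read off from it.\<close>
  have f_eq: "f = (\<lambda>t. ((m t)\<^sup>2 + (p t)\<^sup>2 - F t) / 2)" by (auto simp: F_def)
  have fI: "integrable ?M f"
    unfolding f_eq by (intro integrable_divide Bochner_Integration.integrable_diff
        Bochner_Integration.integrable_add m2 p Fatou)
  have "(\<integral>t. F t \<partial>?M) = (\<integral>t. (m t)\<^sup>2 \<partial>?M) + (\<integral>t. (p t)\<^sup>2 \<partial>?M) - 2 * (\<integral>t. f t \<partial>?M)"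
    unfolding F_def using m2 p(2) fI by simp
  moreover have "(\<integral>t. (m t)\<^sup>2 \<partial>?M) = \<Gamma> b - \<Gamma> a"
    using lebesgue_integral_eq_integral[OF m2] \<Gamma>_diff[of a b] ab by simp
  ultimately have "q b - q a \<le> 2 * (\<integral>t. f t \<partial>?M)" using Fatou(2) by simp
  with fI f show ?thesis by (intro that) (auto simp: q_def)
qed

section \<open>Weak derivatives and weak solutions\<close>

text \<open>\<open>q\<close> need not be differentiable, but the right-hand side of its bound is.
  Multiplied by \<open>exp (- c * s)\<close> it is nonincreasing, because its derivative is a
  nonnegative multiple of \<open>q\<close> minus that right-hand side.\<close>

lemma Gronwall_integral:
  fixes q :: "real \<Rightarrow> real"
  assumes q: "continuous_on {0..T} q" and c: "0 \<le> c"
    and le: "\<And>t. t \<in> {0..T} \<Longrightarrow> q t \<le> K + c * integral {0..t} q"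
    and t: "t \<in> {0..T}"
  shows "q t \<le> K * exp (c * t)"
proof -
  define \<Phi> where "\<Phi> s = K + c * integral {0..s} q" for s
  have cI: "continuous_on {0..T} (\<lambda>s. integral {0..s} q)"
    by (intro indefinite_integral_continuous_1 integrable_continuous_interval q)
  have d: "((\<lambda>s. \<Phi> s * exp (- c * s)) has_real_derivative
      c * q s * exp (- c * s) + exp (- c * s) * (- c) * \<Phi> s) (at s)" if "0 < s" "s < t" for s
  proof -
    have "((\<lambda>s. integral {0..s} q) has_real_derivative q s) (at s within {0..T})"
      by (rule integral_has_real_derivative[OF q]) (use that t in auto)
    then have "((\<lambda>s. integral {0..s} q) has_real_derivative q s) (at s)"
      using that t by (simp add: at_within_Icc_at)
    then show ?thesis
      unfolding \<Phi>_def by (auto intro!: derivative_eq_intros)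
  qed
  have "\<Phi> t * exp (- c * t) \<le> \<Phi> 0 * exp (- c * 0)"
  proof (rule DERIV_nonpos_imp_decreasing_open[of 0 t "\<lambda>s. \<Phi> s * exp (- c * s)"])
    fix s assume s: "0 < s" "s < t"
    have "c * q s \<le> c * \<Phi> s"
      using le[of s] s t c by (intro mult_left_mono) (auto simp: \<Phi>_def)
    then have "(c * q s - c * \<Phi> s) * exp (- c * s) \<le> 0"
      by (simp add: mult_nonpos_nonneg)
    then show "\<exists>y. ((\<lambda>s. \<Phi> s * exp (- c * s)) has_real_derivative y) (at s) \<and> y \<le> 0"
      using d[OF s] by (intro exI conjI) (auto simp: algebra_simps)
  next
    show "continuous_on {0..t} (\<lambda>s. \<Phi> s * exp (- c * s))"
      unfolding \<Phi>_def using t by (intro continuous_intros continuous_on_subset[OF cI]) auto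
  qed (use t in auto)
  also have "\<dots> = K" by (simp add: \<Phi>_def)
  finally have "\<Phi> t \<le> K * exp (c * t)" by (simp add: exp_minus field_simps)
  with le[OF t] show ?thesis by (simp add: \<Phi>_def)
qed

text \<open>Measurability is required of \<open>k\<close> alone; completeness of Lebesgue measure
  passes it on to \<open>f\<close>. This suits weak derivatives, which are fixed only up to null
  sets.\<close>

lemma integral_lebesgue_on_cong_AE:
  fixes f k :: "real \<Rightarrow> real"
  assumes S: "S \<in> sets lebesgue" and k: "k \<in> borel_measurable (lebesgue_on S)"
    and eq: "AE t in lebesgue_on S. f t = k t"
  shows "integral\<^sup>L (lebesgue_on S) f = integral\<^sup>L (lebesgue_on S) k"
proof -
  have kM: "(\<lambda>t. indicator S t *\<^sub>R k t) \<in> borel_measurable lebesgue"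
    using k S by (simp add: borel_measurable_restrict_space_iff)
  have ae: "AE t in lebesgue. indicator S t *\<^sub>R k t = indicator S t *\<^sub>R f t"
    using eq S by (subst (asm) AE_restrict_space_iff) (auto simp: indicator_def elim: AE_mp)
  have "(\<integral>t. indicator S t *\<^sub>R k t \<partial>lebesgue) = (\<integral>t. indicator S t *\<^sub>R f t \<partial>lebesgue)"
    by (rule integral_cong_AE[OF kM borel_measurable_AE[OF kM ae] ae])
  then show ?thesis using S by (simp add: integral_restrict_space)
qed

text \<open>At almost every \<open>t\<close> both values are limits of the same left averages;
  \<open>t = 0\<close> is excluded, having no interval to its left.\<close>

lemma AE_eq_of_integral_eq:
  fixes f k :: "real \<Rightarrow> real"
  assumes f: "f integrable_on {0..T}" "k integrable_on {0..T}"
    and eq: "\<And>s t. 0 \<le> s \<Longrightarrow> s \<le> t \<Longrightarrow> t \<le> T \<Longrightarrow> integral {s..t} f = integral {s..t} k"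
  shows "AE t in lebesgue_on {0..T}. f t = k t"
proof -
  have "AE t in lebesgue. t \<noteq> 0"
    by (rule AE_I'[of "{0}"]) auto
  moreover note lebesgue_differentiation_left[OF f(1)] lebesgue_differentiation_left[OF f(2)]
  ultimately have "AE t in lebesgue. t \<in> {0..T} \<longrightarrow> f t = k t"
  proof eventually_elim
    case (elim t)
    show ?case
    proof
      assume t: "t \<in> {0..T}"
      then have t0: "t \<in> {0<..T}" using elim(1) by auto
      have "\<forall>\<^sub>F h in at_right 0. integral {t - h..t} f / h = integral {t - h..t} k / h"
        unfolding eventually_at_right_field
      proof (intro exI conjI allI impI)
        show "0 < t" using t0 by simp
        show "integral {t - h..t} f / h = integral {t - h..t} k / h" if "0 < h" "h < t" for h
          using eq[of "t - h" t] that t by simp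
      qed
      then have "((\<lambda>h. integral {t - h..t} k / h) \<longlongrightarrow> f t) (at_right 0)"
        using elim(2) t0 by (auto intro: Lim_transform_eventually)
      moreover have "((\<lambda>h. integral {t - h..t} k / h) \<longlongrightarrow> k t) (at_right 0)"
        using elim(3) t0 by blast
      ultimately show "f t = k t"
        by (rule tendsto_unique[rotated]) simp
    qed
  qed
  then show ?thesis by (subst AE_restrict_space_iff) auto
qed

section \<open>Representatives of square-integrable curves in the dual\<close>

lemma dual_zero: "banach_sub V \<Longrightarrow> (\<lambda>_. 0) \<in> dual V"
  using banach_sub_nrm_nonneg by (auto simp: dual_def intro!: exI[of _ 0])

lemma dual_norm_zero: "banach_sub V \<Longrightarrow> dual_norm V (\<lambda>_. 0) = 0"
  using dual_norm_le[of V "\<lambda>_. 0" 0] dual_norm_nonneg[OF dual_zero] by fastforce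

lemma integrable_of_square_integrable_Icc:
  fixes f :: "real \<Rightarrow> real"
  assumes f: "f \<in> borel_measurable (lebesgue_on {a..b})" and f2: "integrable (lebesgue_on {a..b}) (\<lambda>x. (f x)\<^sup>2)"
  shows "integrable (lebesgue_on {a..b}) f"
proof (rule Bochner_Integration.integrable_bound)
  show "integrable (lebesgue_on {a..b}) (\<lambda>x. (f x)\<^sup>2 + 1)"
    by (rule Bochner_Integration.integrable_add[OF f2 continuous_imp_integrable_real]) simp
  have "\<bar>x\<bar> \<le> x\<^sup>2 + 1" for x :: real
    using sum_squares_bound[of "\<bar>x\<bar>" 1] by simp
  then show "AE x in lebesgue_on {a..b}. norm (f x) \<le> norm ((f x)\<^sup>2 + 1)" by simp
qed (rule f)

text \<open>The representative lies in the dual at every time, so its bounds hold without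
  exceptional sets, and it is zero off \<open>{0..T}\<close>, so it may be integrated over intervals
  reaching below 0.\<close>

lemma L2_dual_representative:
  assumes V: "banach_sub V" and g: "L2_dual V T g"
  obtains w where "\<And>t. w t \<in> dual V" "\<And>t. t \<notin> {0..T} \<Longrightarrow> w t = (\<lambda>_. 0)"
    "AE t in lebesgue_on {0..T}. g t = w t"
    "\<And>x. x \<in> carr V \<Longrightarrow> integrable (lebesgue_on {0..T}) (\<lambda>t. w t x)"
    "integrable (lebesgue_on {0..T}) (\<lambda>t. dual_norm V (w t))"
    "integrable (lebesgue_on {0..T}) (\<lambda>t. (dual_norm V (w t))\<^sup>2)"
proof -
  let ?M = "lebesgue_on {0..T}"
  obtain w0 where w0: "w0 \<in> measurable ?M (dual_borel V)" "AE t in ?M. g t = w0 t"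
    "(\<integral>\<^sup>+ t. ennreal ((dual_norm V (w0 t))\<^sup>2) \<partial>?M) < \<infinity>"
    using g unfolding L2_class_def by blast
  define w where "w t = (if t \<in> {0..T} then w0 t else (\<lambda>_. 0))" for t
  have dual: "w t \<in> dual V" for t
    using measurable_space[OF w0(1), of t] V by (auto simp: w_def space_dual_borel dual_zero)
  have wM: "w \<in> measurable ?M (dual_borel V)"
    using w0(1) by (rule measurable_cong[THEN iffD1, rotated]) (simp add: w_def)
  have nM: "(\<lambda>t. dual_norm V (w t)) \<in> borel_measurable ?M"
    by (rule measurable_compose[OF wM measurable_dual_norm[OF V]])
  have "(\<integral>\<^sup>+ t. ennreal ((dual_norm V (w t))\<^sup>2) \<partial>?M) = (\<integral>\<^sup>+ t. ennreal ((dual_norm V (w0 t))\<^sup>2) \<partial>?M)"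
    by (rule nn_integral_cong) (simp add: w_def)
  then have n2: "integrable ?M (\<lambda>t. (dual_norm V (w t))\<^sup>2)"
    using w0(3) nM by (intro integrableI_nonneg) auto
  have n1: "integrable ?M (\<lambda>t. dual_norm V (w t))"
    by (rule integrable_of_square_integrable_Icc[OF nM n2])
  have "integrable ?M (\<lambda>t. w t x)" if x: "x \<in> carr V" for x
  proof (rule Bochner_Integration.integrable_bound)
    show "integrable ?M (\<lambda>t. dual_norm V (w t) * nrm V x)"
      using n1 by (rule integrable_mult_left)
    show "(\<lambda>t. w t x) \<in> borel_measurable ?M"
      by (rule measurable_compose[OF wM measurable_dual_eval[OF V x]])
    show "AE t in ?M. norm (w t x) \<le> norm (dual_norm V (w t) * nrm V x)"
    proof (intro AE_I2)
      fix t
      show "norm (w t x) \<le> norm (dual_norm V (w t) * nrm V x)"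
        using dual_norm_bound[OF dual V x, of t] by (simp add: order_trans[OF _ abs_ge_self])
    qed
  qed
  moreover have "AE t in ?M. g t = w t"
    using w0(2) AE_space by eventually_elim (simp add: w_def)
  moreover have "w t = (\<lambda>_. 0)" if "t \<notin> {0..T}" for t
    using that unfolding w_def by (rule if_not_P)
  ultimately show ?thesis
    using that[of w] dual n1 n2 by blast
qed

text \<open>Pairing with a fixed \<open>x\<close> reduces the claim to the scalar fundamental
  theorem; \<open>w\<close> may replace \<open>g\<close> under the integral because they agree
  almost everywhere.\<close>

lemma weak_derivative_increment:
  fixes u :: "real \<Rightarrow> 'h::real_inner"
  assumes T: "T > 0" and u: "continuous_on {0..T} u" and g: "weak_derivative V T u g"
    and w: "AE t in lebesgue_on {0..T}. g t = w t" "integrable (lebesgue_on {0..T}) (\<lambda>t. w t x)"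
    and x: "x \<in> carr V" and st: "0 \<le> s" "s \<le> t" "t \<le> T"
  shows "inner (u t - u s) x = integral {s..t} (\<lambda>r. w r x)"
proof -
  have "inner (u t) x - inner (u s) x = integral {s..t} (\<lambda>r. w r x)"
  proof (rule weak_derivative_fundamental_theorem[OF T _ w(2) _ st])
    show "continuous_on {0..T} (\<lambda>t. inner (u t) x)" by (intro continuous_intros u)
    fix \<eta> assume \<eta>: "test_function T \<eta>"
    then have "\<eta> differentiable_on UNIV" unfolding test_function_def by (metis funpow_0)
    then have "continuous_on {0..T} \<eta>"
      by (meson continuous_on_subset differentiable_imp_continuous_on subset_UNIV)
    then have "\<eta> \<in> borel_measurable (lebesgue_on {0..T})"
      by (rule continuous_imp_measurable_on_sets_lebesgue) simp
    then have "(\<lambda>t. \<eta> t * w t x) \<in> borel_measurable (lebesgue_on {0..T})"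
      using w(2) by (intro borel_measurable_times) auto
    then have "(\<integral>t. \<eta> t * g t x \<partial>lebesgue_on {0..T}) = (\<integral>t. \<eta> t * w t x \<partial>lebesgue_on {0..T})"
      by (rule integral_lebesgue_on_cong_AE[rotated]) (use w(1) in auto)
    then show "(\<integral>t. deriv \<eta> t * inner (u t) x \<partial>lebesgue_on {0..T}) = - (\<integral>t. \<eta> t * w t x \<partial>lebesgue_on {0..T})"
      using g \<eta> x unfolding weak_derivative_def by metis
  qed
  then show ?thesis by (simp add: inner_diff_left)
qed

section \<open>Embeddings and regularity classes\<close>

lemma gelfand_triple_banach_sub:
  assumes "gelfand_triple V X"
  shows "banach_sub V" "banach_sub X"
  using assms by (auto simp: gelfand_triple_def)

lemma gelfand_triple_carr_subset:
  assumes "gelfand_triple V X"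
  shows "carr V \<subseteq> carr X"
proof -
  have "topspace (ntop V) = carr V" "topspace (ntop X) = carr X"
    using gelfand_triple_banach_sub[OF assms]
    by (auto simp: ntop_def Metric_space.topspace_mtopology banach_sub_Metric_space)
  moreover have "continuous_map (ntop V) (ntop X) (\<lambda>x. x)"
    using assms by (simp add: gelfand_triple_def)
  ultimately show ?thesis
    using continuous_map_image_subset_topspace[of "ntop V" "ntop X" "\<lambda>x. x"] by simp
qed

lemma C0_in_carr:
  assumes "banach_sub X" "C0_in X T u" "t \<in> {0..T}"
  shows "u t \<in> carr X"
proof -
  have "topspace (ntop X) = carr X"
    using assms(1) by (simp add: ntop_def Metric_space.topspace_mtopology banach_sub_Metric_space)
  then show ?thesis
    using assms continuous_map_image_subset_topspace[of "top_of_set {0..T}" "ntop X" u]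
    by (auto simp: C0_in_def)
qed

lemma C0_in_continuous_on:
  assumes "gelfand_triple V X" "C0_in X T u"
  shows "continuous_on {0..T} u"
proof -
  have "continuous_map (ntop X) euclidean (\<lambda>x. x)"
    using assms by (simp add: gelfand_triple_def)
  with assms(2) have "continuous_map (top_of_set {0..T}) euclidean ((\<lambda>x. x) \<circ> u)"
    unfolding C0_in_def by (rule continuous_map_compose)
  then show ?thesis by (simp add: o_def)
qed

text \<open>\<open>p\<close> is a substitute for the norm along \<open>u\<close>: on a null set
  \<open>u t\<close> may leave \<open>carr V\<close>, where \<open>nrm V\<close> carries no
  information.\<close>

lemma L2_in_nrm:
  assumes V: "banach_sub V" and "L2_in V T u"
  obtains p where "AE t in lebesgue_on {0..T}. u t \<in> carr V \<and> p t = nrm V (u t)"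
    "integrable (lebesgue_on {0..T}) (\<lambda>t. (p t)\<^sup>2)"
proof -
  let ?M = "lebesgue_on {0..T}"
  obtain w where w: "w \<in> measurable ?M (nborel V)" "AE t in ?M. u t = w t"
    "(\<integral>\<^sup>+ t. ennreal ((nrm V (w t))\<^sup>2) \<partial>?M) < \<infinity>"
    using assms(2) unfolding L2_class_def by blast
  have "(\<lambda>t. nrm V (w t)) \<in> borel_measurable ?M"
    by (rule measurable_compose[OF w(1) measurable_nrm[OF V]])
  then have "integrable ?M (\<lambda>t. (nrm V (w t))\<^sup>2)"
    using w(3) by (intro integrableI_nonneg) auto
  moreover have "AE t in ?M. u t \<in> carr V \<and> nrm V (w t) = nrm V (u t)"
    using w(2) AE_space
  proof eventually_elim
    case (elim t)
    then show ?case using measurable_space[OF w(1), of t] by (simp add: space_nborel V)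
  qed
  ultimately show ?thesis using that[of "\<lambda>t. nrm V (w t)"] by blast
qed

section \<open>Extension beyond the time interval\<close>

lemma integrable_on_Icc_of_zero_outside:
  fixes f :: "real \<Rightarrow> real"
  assumes "integrable (lebesgue_on {0..T}) f" "\<And>t. t \<notin> {0..T} \<Longrightarrow> f t = 0"
  shows "f integrable_on {a..b}"
proof -
  have "f integrable_on {0..T}" by (rule integrable_on_lebesgue_on[OF assms(1)]) simp
  then have "f integrable_on UNIV"
    by (rule integrable_on_superset) (use assms(2) in auto)
  then show ?thesis by (rule integrable_on_subinterval) simp
qed

text \<open>Backward quotients at times near 0 reach into negative time. With the derivative
  extended by zero, increments there match those of a curve frozen at its initial value.\<close>

lemma integral_clamp_of_zero_outside:
  fixes f :: "real \<Rightarrow> real"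
  assumes f: "\<And>t. t \<notin> {0..T} \<Longrightarrow> f t = 0" and T: "0 \<le> T" and t: "t \<le> T"
  shows "integral {s..t} f = integral {max 0 s..max 0 t} f"
proof -
  have "(\<lambda>r. if r \<in> {0..T} then f r else 0) = f" using f by auto
  then have "integral {s..t} f = integral ({0..T} \<inter> {s..t}) f"
    using integral_restrict_Int[of "{s..t}" "{0..T}" f] by simp
  also have "\<dots> = integral {max 0 s..max 0 t} f"
  proof (cases "t < 0")
    case True
    then have e: "{0..T} \<inter> {s..t} = {}" by auto
    show ?thesis unfolding e using True by (cases "s \<le> 0") auto
  next
    case False
    then have "{0..T} \<inter> {s..t} = {max 0 s..max 0 t}" using t by auto
    then show ?thesis by (simp only:)
  qed
  finally show ?thesis .
qed

lemma AE_lebesgue_on_subset: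
  assumes "AE x in lebesgue_on B. P x" "A \<subseteq> B" "A \<in> sets lebesgue" "B \<in> sets lebesgue"
  shows "AE x in lebesgue_on A. P x"
proof -
  have "AE x in lebesgue. x \<in> B \<longrightarrow> P x"
    using assms(1,4) by (subst (asm) AE_restrict_space_iff) auto
  then have "AE x in lebesgue. x \<in> A \<longrightarrow> P x"
    by (rule eventually_mono) (use assms(2) in auto)
  then show ?thesis using assms(3) by (subst AE_restrict_space_iff) auto
qed

lemma weak_derivative_L2_dual: "weak_derivative V T u g \<Longrightarrow> L2_dual V T g"
  by (simp add: weak_derivative_def)

lemma energy_inequality_regular:
  fixes \<phi> :: "real \<Rightarrow> 'h::{real_inner, banach, second_countable_topology}"
  assumes V: "gelfand_triple V X" and T: "T > 0" and cont: "continuous_on {0..T} \<phi>"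
    and \<phi>: "L2_in V T \<phi>" and g: "weak_derivative V T \<phi> g" and t: "t \<in> {0..T}"
  obtains f where "integrable (lebesgue_on {0..t}) f"
    "AE s in lebesgue_on {0..t}. f s = g s (\<phi> s)"
    "(norm (\<phi> t))\<^sup>2 - (norm (\<phi> 0))\<^sup>2 \<le> 2 * (\<integral>s. f s \<partial>lebesgue_on {0..t})"
proof -
  have bV: "banach_sub V" by (rule gelfand_triple_banach_sub[OF V])
  have "separable_space (ntop V)" using V by (simp add: gelfand_triple_def)
  then obtain D where D: "countable D" "D \<subseteq> carr V"
    "\<And>x e. x \<in> carr V \<Longrightarrow> 0 < e \<Longrightarrow> \<exists>d\<in>D. nrm V (x - d) < e"
    using separable_sub_countable_dense[OF bV] by blast
  obtain w where w: "\<And>t. w t \<in> dual V" "\<And>t. t \<notin> {0..T} \<Longrightarrow> w t = (\<lambda>_. 0)"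
    "AE t in lebesgue_on {0..T}. g t = w t"
    "\<And>x. x \<in> carr V \<Longrightarrow> integrable (lebesgue_on {0..T}) (\<lambda>t. w t x)"
    "integrable (lebesgue_on {0..T}) (\<lambda>t. dual_norm V (w t))"
    "integrable (lebesgue_on {0..T}) (\<lambda>t. (dual_norm V (w t))\<^sup>2)"
    by (rule L2_dual_representative[OF bV weak_derivative_L2_dual[OF g]]) (rule that; assumption)
  obtain p where p: "AE t in lebesgue_on {0..T}. \<phi> t \<in> carr V \<and> p t = nrm V (\<phi> t)"
    "integrable (lebesgue_on {0..T}) (\<lambda>t. (p t)\<^sup>2)"
    by (rule L2_in_nrm[OF bV \<phi>])
  have AEsub: "AE s in lebesgue_on {0..t}. P s" if "AE s in lebesgue_on {0..T}. P s" for P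
    by (rule AE_lebesgue_on_subset[OF that]) (use t in auto)
  \<comment> \<open>Freezing the curve at its initial value keeps it continuous and agrees with
    \<open>w\<close> being zero at negative times.\<close>
  define \<phi>' where "\<phi>' s = \<phi> (max 0 s)" for s
  have eq: "\<phi>' s = \<phi> s" if "s \<ge> 0" for s using that by (simp add: \<phi>'_def)
  obtain f where f: "integrable (lebesgue_on {0..t}) f"
    "AE s in lebesgue_on {0..t}. f s = w s (\<phi>' s)"
    "(norm (\<phi>' t))\<^sup>2 - (norm (\<phi>' 0))\<^sup>2 \<le> 2 * (\<integral>s. f s \<partial>lebesgue_on {0..t})"
  proof (rule energy_inequality[OF bV D, of 0 t \<phi>' w "\<lambda>s. dual_norm V (w s)" p])
    show "0 \<le> t" using t by simp
    show "continuous_on {0 - 1..t} \<phi>'"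
      unfolding \<phi>'_def by (rule continuous_on_compose2[OF cont]) (use t in \<open>auto intro!: continuous_intros\<close>)
    show "(\<lambda>r. w r x) integrable_on {0 - 1..t}" if "x \<in> carr V" for x
      by (rule integrable_on_Icc_of_zero_outside[OF w(4)[OF that]]) (simp add: w(2))
    show "(\<lambda>r. dual_norm V (w r)) integrable_on {0 - 1..t}"
      by (rule integrable_on_Icc_of_zero_outside[OF w(5)]) (simp add: w(2) dual_norm_zero bV)
    show "(\<lambda>r. (dual_norm V (w r))\<^sup>2) integrable_on {0 - 1..t}"
      by (rule integrable_on_Icc_of_zero_outside[OF w(6)]) (simp add: w(2) dual_norm_zero bV)
    show "inner (\<phi>' b - \<phi>' a) x = integral {a..b} (\<lambda>r. w r x)"
      if x: "x \<in> carr V" and ab: "0 - 1 \<le> a" "a \<le> b" "b \<le> t" for x a b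
    proof -
      have "integral {a..b} (\<lambda>r. w r x) = integral {max 0 a..max 0 b} (\<lambda>r. w r x)"
        using t ab by (intro integral_clamp_of_zero_outside[of T]) (auto simp: w(2))
      also have "\<dots> = inner (\<phi> (max 0 b) - \<phi> (max 0 a)) x"
        using t ab by (intro weak_derivative_increment[OF T cont g w(3) w(4) x, symmetric] x) auto
      finally show ?thesis by (simp add: \<phi>'_def)
    qed
    show "w r (v - y) = w r v - w r y" if "v \<in> carr V" "y \<in> carr V" for r v y
      by (rule dual_apply_diff[OF w(1) bV that])
    show "\<bar>w r x\<bar> \<le> dual_norm V (w r) * nrm V x" if "x \<in> carr V" for r x
      by (rule dual_norm_bound[OF w(1) bV that])
    show "0 \<le> dual_norm V (w r)" for r by (rule dual_norm_nonneg[OF w(1) bV])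
    show "AE s in lebesgue_on {0..t}. \<phi>' s \<in> carr V \<and> p s = nrm V (\<phi>' s)"
      using AEsub[OF p(1)] AE_space by eventually_elim (simp add: eq)
    show "integrable (lebesgue_on {0..t}) (\<lambda>t. (p t)\<^sup>2)"
      by (rule integrable_lebesgue_on_subset[OF p(2)]) (use t in auto)
  qed blast
  show ?thesis
  proof (rule that[OF f(1)])
    show "AE s in lebesgue_on {0..t}. f s = g s (\<phi> s)"
      using f(2) AEsub[OF w(3)] AE_space by eventually_elim (simp add: eq)
    show "(norm (\<phi> t))\<^sup>2 - (norm (\<phi> 0))\<^sup>2 \<le> 2 * (\<integral>s. f s \<partial>lebesgue_on {0..t})"
      using f(3) t by (simp add: eq)
  qed
qed

lemma weak_solution_increment:
  assumes sol: "weak_solution V T A N v0 v" and x: "x \<in> carr V" and st: "0 \<le> s" "s \<le> t" "t \<le> T"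
  shows "inner (v t - v s) x = integral {s..t} (\<lambda>r. A (v r) x + N r (v r) x)"
    and "(\<lambda>r. A (v r) x + N r (v r) x) integrable_on {s..t}"
proof -
  let ?k = "\<lambda>r. A (v r) x + N r (v r) x"
  have *: "?k integrable_on {0..t}" "inner (v t) x = inner v0 x + integral {0..t} ?k" if "t \<in> {0..T}" for t
  proof -
    have I: "integrable (lebesgue_on {0..t}) (\<lambda>s. A (v s) x)" "integrable (lebesgue_on {0..t}) (\<lambda>s. N s (v s) x)"
      and e: "inner (v t) x = inner v0 x + (\<integral>s. A (v s) x \<partial>lebesgue_on {0..t}) + (\<integral>s. N s (v s) x \<partial>lebesgue_on {0..t})"
      using sol x that by (auto simp: weak_solution_def)
    have Ik: "integrable (lebesgue_on {0..t}) ?k" using I by simp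
    show "?k integrable_on {0..t}" by (rule integrable_on_lebesgue_on[OF Ik]) simp
    show "inner (v t) x = inner v0 x + integral {0..t} ?k"
      using e lebesgue_integral_eq_integral[OF Ik] I by simp
  qed
  show "?k integrable_on {s..t}"
    by (rule integrable_on_subinterval[OF *(1)[of t]]) (use st in auto)
  show "inner (v t - v s) x = integral {s..t} ?k"
    using *(2)[of t] *(2)[of s] st Henstock_Kurzweil_Integration.integral_combine[OF st(1,2) *(1)[of t]]
    by (simp add: inner_diff_left)
qed

section \<open>The pathwise estimate\<close>

text \<open>For each vector of \<open>D\<close>, both sides have the same integral over every
  subinterval, hence agree almost everywhere. Countability of \<open>D\<close> merges the null sets;
  \<open>AN\<close> makes the right-hand side a bounded functional, so that agreement on
  \<open>D\<close> extends to \<open>V\<close>.\<close>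

lemma weak_derivative_difference_solution:
  fixes u v :: "real \<Rightarrow> 'h::{real_inner, banach, second_countable_topology}"
  assumes V: "gelfand_triple V X" and T: "T > 0"
    and u: "continuous_on {0..T} u" and v: "continuous_on {0..T} v"
    and gu: "weak_derivative V T u gu" and g: "weak_derivative V T (\<lambda>t. u t - v t) g"
    and sol: "weak_solution V T A N v0 v"
    and AN: "AE t in lebesgue_on {0..T}. A (v t) \<in> dual V \<and> N t (v t) \<in> dual V"
  shows "AE t in lebesgue_on {0..T}. g t = (\<lambda>x. gu t x - A (v t) x - N t (v t) x)"
proof -
  have bV: "banach_sub V" by (rule gelfand_triple_banach_sub[OF V])
  have "separable_space (ntop V)" using V by (simp add: gelfand_triple_def)
  then obtain D where D: "countable D" "D \<subseteq> carr V"
    "\<And>x e. x \<in> carr V \<Longrightarrow> 0 < e \<Longrightarrow> \<exists>d\<in>D. nrm V (x - d) < e"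
    using separable_sub_countable_dense[OF bV] by blast
  obtain wu where wu: "\<And>t. wu t \<in> dual V" "AE t in lebesgue_on {0..T}. gu t = wu t"
    "\<And>x. x \<in> carr V \<Longrightarrow> integrable (lebesgue_on {0..T}) (\<lambda>t. wu t x)"
    by (rule L2_dual_representative[OF bV weak_derivative_L2_dual[OF gu]]) (rule that; assumption)
  obtain w where w: "\<And>t. w t \<in> dual V" "AE t in lebesgue_on {0..T}. g t = w t"
    "\<And>x. x \<in> carr V \<Longrightarrow> integrable (lebesgue_on {0..T}) (\<lambda>t. w t x)"
    by (rule L2_dual_representative[OF bV weak_derivative_L2_dual[OF g]]) (rule that; assumption)
  have "AE t in lebesgue_on {0..T}. w t d = wu t d - (A (v t) d + N t (v t) d)" if d: "d \<in> D" for d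
  proof (rule AE_eq_of_integral_eq)
    have dV: "d \<in> carr V" using d D by blast
    have Iu: "(\<lambda>t. wu t d) integrable_on {0..T}"
      by (rule integrable_on_lebesgue_on[OF wu(3)[OF dV]]) simp
    have Iv: "(\<lambda>t. A (v t) d + N t (v t) d) integrable_on {0..T}"
      by (rule weak_solution_increment[OF sol dV]) (use T in auto)
    show "(\<lambda>t. w t d) integrable_on {0..T}"
      by (rule integrable_on_lebesgue_on[OF w(3)[OF dV]]) simp
    show "(\<lambda>t. wu t d - (A (v t) d + N t (v t) d)) integrable_on {0..T}"
      by (rule integrable_diff[OF Iu Iv])
    fix s t assume st: "0 \<le> s" "s \<le> t" "t \<le> T"
    have "integral {s..t} (\<lambda>r. w r d) = inner ((u t - v t) - (u s - v s)) d"
      by (rule weak_derivative_increment[OF T _ g w(2) w(3)[OF dV] dV st, symmetric])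
         (intro continuous_intros u v)
    also have "\<dots> = inner (u t - u s) d - inner (v t - v s) d"
      by (simp add: inner_diff_left)
    also have "\<dots> = integral {s..t} (\<lambda>r. wu r d) - integral {s..t} (\<lambda>r. A (v r) d + N r (v r) d)"
      using weak_derivative_increment[OF T u gu wu(2) wu(3)[OF dV] dV st]
        weak_solution_increment(1)[OF sol dV st] by simp
    also have "\<dots> = integral {s..t} (\<lambda>r. wu r d - (A (v r) d + N r (v r) d))"
      by (rule integral_diff[symmetric]; rule integrable_on_subinterval[OF Iu] integrable_on_subinterval[OF Iv])
         (use st in auto)
    finally show "integral {s..t} (\<lambda>r. w r d) = integral {s..t} (\<lambda>r. wu r d - (A (v r) d + N r (v r) d))" .
  qed
  then have "AE t in lebesgue_on {0..T}. \<forall>d\<in>D. w t d = wu t d - (A (v t) d + N t (v t) d)"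
    using D(1) by (intro AE_ball_countable') auto
  then show ?thesis
    using AN w(2) wu(2)
  proof eventually_elim
    case (elim t)
    have "w t = (\<lambda>x. wu t x - A (v t) x - N t (v t) x)"
    proof (rule dual_eqI_dense[OF bV w(1) _ D(2,3)])
      show "(\<lambda>x. wu t x - A (v t) x - N t (v t) x) \<in> dual V"
        using elim by (intro dual_diff wu(1)) auto
    qed (use elim in auto)
    then show ?case using elim by simp
  qed
qed

lemma linear_to_dual_diff:
  assumes "linear_to_dual V A" "x \<in> carr V" "y \<in> carr V"
  shows "A (x - y) w = A x w - A y w"
proof -
  have "A (1 *\<^sub>R x + (-1) *\<^sub>R y) = (\<lambda>v. 1 * A x v + (-1) * A y v)"
    using assms unfolding linear_to_dual_def by blast
  then show ?thesis by simp
qed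

lemma pathwise_estimate:
  fixes u v z :: "real \<Rightarrow> 'h::{real_inner, banach, second_countable_topology}"
  assumes V: "gelfand_triple V X" and T: "T > 0"
    and A: "linear_to_dual V A" "A \<in> measurable (nborel V) (dual_borel V)"
    and F: "F \<in> measurable (nborel X) (dual_borel V)"
    and C0: "C0_in X T u" "C0_in X T v" "C0_in X T z"
    and sol: "weak_solution V T A (\<lambda>s v. F (v + z s)) v0 v"
    and reg: "regular V T (\<lambda>t. u t - v t)"
    and \<delta>: "\<delta> > 0" and C: "C \<ge> 0"
    and small: "\<And>t. t \<in> {0..T} \<Longrightarrow> c * nrm X (u t + z t) \<le> 1"
    and one_sided: "\<And>\<phi> \<psi>. \<phi> \<in> carr V \<Longrightarrow> \<psi> \<in> carr X \<Longrightarrow> c * nrm X \<psi> \<le> 1 \<Longrightarrow>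
        A \<phi> \<phi> + (F (\<phi> + \<psi>) \<phi> - F \<psi> \<phi>) \<le> - \<delta> * (nrm V \<phi>)\<^sup>2 + C * (norm \<phi>)\<^sup>2"
    and \<gamma>: "\<gamma> \<ge> 0" "residual_sq_integral V X T A F u z \<le> ennreal \<gamma>"
    and t: "t \<in> {0..T}"
  shows "(norm (u t - v t))\<^sup>2 \<le> ((norm (u 0 - v 0))\<^sup>2 + \<gamma> / (2 * \<delta>)) * exp (2 * C * t)"
proof -
  have bV: "banach_sub V" and bX: "banach_sub X"
    using gelfand_triple_banach_sub[OF V] by auto
  have VX: "carr V \<subseteq> carr X" by (rule gelfand_triple_carr_subset[OF V])
  have uc: "continuous_on {0..T} u" and vc: "continuous_on {0..T} v"
    using C0_in_continuous_on[OF V] C0 by auto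
  have uX: "u t \<in> carr X" and vX: "v t \<in> carr X" and zX: "z t \<in> carr X" if "t \<in> {0..T}" for t
    using C0_in_carr[OF bX _ that] C0 by auto
  have addX: "x + y \<in> carr X" if "x \<in> carr X" "y \<in> carr X" for x y
    using that by (intro subspace_add banach_sub_subspace bX)
  have Adual: "A x \<in> dual V" if "x \<in> carr V" for x
    using measurable_space[OF A(2), of x] that by (simp add: space_nborel space_dual_borel bV)
  have Fdual: "F x \<in> dual V" if "x \<in> carr X" for x
    using measurable_space[OF F, of x] that by (simp add: space_nborel space_dual_borel bV bX)
  define \<phi> where "\<phi> t = u t - v t" for t
  have \<phi>c: "continuous_on {0..T} \<phi>" unfolding \<phi>_def by (intro continuous_intros uc vc)
  have \<phi>L2: "L2_in V T \<phi>" and vL2: "L2_in V T v"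
    using reg sol by (auto simp: regular_def weak_solution_def \<phi>_def[abs_def])
  have \<phi>V: "AE t in lebesgue_on {0..T}. \<phi> t \<in> carr V"
    by (rule L2_in_nrm[OF bV \<phi>L2], erule eventually_mono) simp
  have vV: "AE t in lebesgue_on {0..T}. v t \<in> carr V"
    by (rule L2_in_nrm[OF bV vL2], erule eventually_mono) simp
  obtain g where g: "weak_derivative V T \<phi> g"
    using reg unfolding regular_def \<phi>_def[abs_def] by blast
  \<comment> \<open>Without a weak derivative the residual integral would be
    \<open>\<infinity>\<close>, so its bound guarantees that the choice in \<open>time_deriv\<close>
    is a genuine derivative.\<close>
  have ex: "\<exists>gu. weak_derivative V T u gu"
    using \<gamma>(2) by (auto simp: residual_sq_integral_def top_unique split: if_splits)
  define gu where "gu = time_deriv V T u"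
  have gu: "weak_derivative V T u gu"
    unfolding gu_def time_deriv_def using ex by (rule someI_ex)
  obtain wu where wu: "\<And>t. wu t \<in> dual V" "AE t in lebesgue_on {0..T}. gu t = wu t"
    by (rule L2_dual_representative[OF bV weak_derivative_L2_dual[OF gu]]) (rule that; assumption)
  define R where "R t = residual V T A F u z t" for t
  \<comment> \<open>\<open>\<rho>\<close> need not be measurable; its \<open>nn_integral\<close> is then a lower integral, which is enough since
    only measurable functions below \<open>\<rho>\<close> are integrated.\<close>
  define \<rho> where "\<rho> t = (if u t \<in> carr V \<and> u t + z t \<in> carr X then (dual_enorm V (R t))\<^sup>2 else \<infinity>)" for t
  have \<rho>: "(\<integral>\<^sup>+ t. \<rho> t \<partial>lebesgue_on {0..T}) \<le> ennreal \<gamma>"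
    using \<gamma>(2) ex by (simp add: residual_sq_integral_def \<rho>_def R_def cong: if_cong)

  have AN: "AE t in lebesgue_on {0..T}. A (v t) \<in> dual V \<and> F (v t + z t) \<in> dual V"
    using vV AE_space by eventually_elim (auto intro!: Adual Fdual addX vX zX)
  have geq: "AE t in lebesgue_on {0..T}. g t = (\<lambda>x. gu t x - A (v t) x - F (v t + z t) x)"
    by (rule weak_derivative_difference_solution[OF V T uc vc gu g[unfolded \<phi>_def[abs_def]] sol AN])
  \<comment> \<open>Young's inequality multiplied by \<open>2 * \<delta>\<close> to avoid fractions;
    \<open>max 0\<close> makes the conversion to \<open>ennreal\<close> faithful.\<close>
  have key: "AE t in lebesgue_on {0..T}.
      ennreal (max 0 (2 * \<delta> * (2 * g t (\<phi> t) - 2 * C * (norm (\<phi> t))\<^sup>2))) \<le> \<rho> t"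
    using geq \<phi>V vV wu(2) AE_space
  proof eventually_elim
    case (elim t)
    then have t: "t \<in> {0..T}" by simp
    have uV: "u t \<in> carr V"
      using elim(2,3) subspace_add[OF banach_sub_subspace[OF bV], of "\<phi> t" "v t"] by (simp add: \<phi>_def)
    have uzX: "u t + z t \<in> carr X" by (intro addX uX zX t)
    have Rt: "R t = (\<lambda>x. gu t x - A (u t) x - F (u t + z t) x)"
      by (simp add: R_def residual_def gu_def)
    have RV: "R t \<in> dual V"
      unfolding Rt using elim(4) wu(1)[of t] uV uzX by (intro dual_diff Adual Fdual) auto
    let ?r = "dual_norm V (R t)" and ?p = "nrm V (\<phi> t)"
    have r0: "0 \<le> ?r" by (rule dual_norm_nonneg[OF RV bV])
    have \<rho>t: "\<rho> t = ennreal (?r\<^sup>2)"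
      using uV uzX RV r0 by (simp add: \<rho>_def dual_enorm_def ennreal_power)
    \<comment> \<open>Functionals are odd and norms even, so the estimate at
      \<open>- \<phi> t\<close> becomes one at \<open>\<phi> t\<close> with the two values of
      \<open>F\<close> exchanged.\<close>
    have m\<phi>: "- \<phi> t \<in> carr V" using elim(2) by (intro subspace_neg banach_sub_subspace bV)
    have neg: "f (- \<phi> t) = - f (\<phi> t)" if "f \<in> dual V" for f
      using dual_apply_diff[OF that bV subspace_0[OF banach_sub_subspace[OF bV]] elim(2)]
        dual_apply_diff[OF that bV elim(2) elim(2)] by simp
    have "nrm V (- \<phi> t) = ?p"
      using banach_sub_nrm_scaleR[OF bV elim(2), of "-1"] by simp
    moreover have "A (- \<phi> t) (- \<phi> t) = A (\<phi> t) (\<phi> t)"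
      using linear_to_dual_diff[OF A(1) subspace_0[OF banach_sub_subspace[OF bV]] elim(2)]
        linear_to_dual_diff[OF A(1) elim(2) elim(2)] neg[OF Adual[OF elim(2)]] by simp
    moreover have "- \<phi> t + (u t + z t) = v t + z t" by (simp add: \<phi>_def)
    moreover have "F (v t + z t) (- \<phi> t) = - F (v t + z t) (\<phi> t)" "F (u t + z t) (- \<phi> t) = - F (u t + z t) (\<phi> t)"
      using t by (auto intro!: neg Fdual addX uX vX zX)
    ultimately have "A (\<phi> t) (\<phi> t) + (F (u t + z t) (\<phi> t) - F (v t + z t) (\<phi> t)) \<le> - \<delta> * ?p\<^sup>2 + C * (norm (\<phi> t))\<^sup>2"
      using one_sided[OF m\<phi> uzX small[OF t]] by (simp only: norm_minus_cancel)
    moreover have "g t (\<phi> t) = R t (\<phi> t) + A (\<phi> t) (\<phi> t) + (F (u t + z t) (\<phi> t) - F (v t + z t) (\<phi> t))"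
      using elim(1) linear_to_dual_diff[OF A(1) uV elim(3)] by (simp add: Rt \<phi>_def)
    moreover have "R t (\<phi> t) \<le> ?r * ?p"
      using dual_norm_bound[OF RV bV elim(2)] by simp
    ultimately have "g t (\<phi> t) - C * (norm (\<phi> t))\<^sup>2 \<le> ?r * ?p - \<delta> * ?p\<^sup>2" by simp
    then have "4 * \<delta> * (g t (\<phi> t) - C * (norm (\<phi> t))\<^sup>2) \<le> 4 * \<delta> * (?r * ?p - \<delta> * ?p\<^sup>2)"
      using \<delta> by (intro mult_left_mono) auto
    \<comment> \<open>Completing the square: the coercive term absorbs the unknown norm
      \<open>?p\<close> entirely.\<close>
    also have "\<dots> = ?r\<^sup>2 - (?r - 2 * \<delta> * ?p)\<^sup>2"
      by (simp add: power2_eq_square algebra_simps)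
    also have "\<dots> \<le> ?r\<^sup>2" by simp
    finally have "max 0 (2 * \<delta> * (2 * g t (\<phi> t) - 2 * C * (norm (\<phi> t))\<^sup>2)) \<le> ?r\<^sup>2"
      by (simp add: algebra_simps)
    then show ?case unfolding \<rho>t by (rule ennreal_leI)
  qed

  define q where "q t = (norm (\<phi> t))\<^sup>2" for t
  have qc: "continuous_on {0..T} q" unfolding q_def by (intro continuous_intros \<phi>c)
  have "q t \<le> (q 0 + \<gamma> / (2 * \<delta>)) + 2 * C * integral {0..t} q" if t: "t \<in> {0..T}" for t
  proof -
    let ?M = "lebesgue_on {0..t}"
    obtain f where f: "integrable ?M f" "AE s in ?M. f s = g s (\<phi> s)"
      "q t - q 0 \<le> 2 * (\<integral>s. f s \<partial>?M)"
      unfolding q_def by (rule energy_inequality_regular[OF V T \<phi>c \<phi>L2 g t])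
    have qct: "continuous_on {0..t} q" by (rule continuous_on_subset[OF qc]) (use t in auto)
    have qI: "integrable ?M q" by (rule continuous_imp_integrable_real[OF qct])
    define k where "k s = max 0 (2 * \<delta> * (2 * f s - 2 * C * q s))" for s
    have k0: "0 \<le> k s" for s by (simp add: k_def)
    have kI: "integrable ?M k"
      unfolding k_def using f(1) qI
      by (intro Bochner_Integration.integrable_max Bochner_Integration.integrable_mult_right
          Bochner_Integration.integrable_diff) auto
    have "AE s in ?M. ennreal (k s) \<le> \<rho> s"
    proof -
      have "AE s in ?M. ennreal (max 0 (2 * \<delta> * (2 * g s (\<phi> s) - 2 * C * (norm (\<phi> s))\<^sup>2))) \<le> \<rho> s"
        by (rule AE_lebesgue_on_subset[OF key]) (use t in auto)
      then show ?thesis using f(2) by eventually_elim (simp add: k_def q_def)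
    qed
    then have "(\<integral>\<^sup>+ s. ennreal (k s) \<partial>?M) \<le> (\<integral>\<^sup>+ s. \<rho> s \<partial>?M)"
      by (rule nn_integral_mono_AE)
    \<comment> \<open>Enlarging the domain makes the bound independent of \<open>t\<close>, as
      Gronwall's lemma requires of its constant.\<close>
    also have "\<dots> \<le> (\<integral>\<^sup>+ s. \<rho> s \<partial>lebesgue_on {0..T})"
      using t by (subst (1 2) nn_integral_restrict_space) (auto intro!: nn_integral_mono simp: indicator_def)
    also note \<rho>
    finally have "ennreal (\<integral>s. k s \<partial>?M) \<le> ennreal \<gamma>"
      using nn_integral_eq_integral[OF kI] k0 by simp
    then have k\<gamma>: "(\<integral>s. k s \<partial>?M) \<le> \<gamma>" using \<gamma>(1) by (simp add: ennreal_le_iff)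
    have "(\<integral>s. 2 * \<delta> * (2 * f s - 2 * C * q s) \<partial>?M) \<le> (\<integral>s. k s \<partial>?M)"
      using f(1) qI kI by (intro integral_mono) (auto simp: k_def)
    then have "2 * \<delta> * (2 * (\<integral>s. f s \<partial>?M) - 2 * C * (\<integral>s. q s \<partial>?M)) \<le> \<gamma>"
      using k\<gamma> f(1) qI by simp
    then have "2 * (\<integral>s. f s \<partial>?M) - 2 * C * (\<integral>s. q s \<partial>?M) \<le> \<gamma> / (2 * \<delta>)"
      using \<delta> by (simp add: pos_le_divide_eq mult.commute)
    moreover have "(\<integral>s. q s \<partial>?M) = integral {0..t} q"
      by (rule lebesgue_integral_eq_integral[OF qI]) simp
    ultimately show ?thesis using f(3) by simp
  qed
  from Gronwall_integral[OF qc _ this t] C show ?thesis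
    by (simp add: q_def \<phi>_def)
qed

section \<open>The probabilistic estimate\<close>

lemma C0_in_nrm_bounded:
  assumes X: "banach_sub X" and u: "C0_in X T u"
  shows "\<exists>B. \<forall>t\<in>{0..T}. nrm X (u t) \<le> B"
proof -
  have "continuous_map (ntop X) euclidean (nrm X)"
    unfolding ntop_def
    by (rule continuous_map_Lipschitz_mtopology[where L = 1])
       (auto simp: banach_sub_Metric_space ndist_def banach_sub_nrm_diff_le X)
  with u have "continuous_map (top_of_set {0..T}) euclidean (nrm X \<circ> u)"
    unfolding C0_in_def by (rule continuous_map_compose)
  then have "continuous_on {0..T} (nrm X \<circ> u)" by simp
  then have "bounded ((nrm X \<circ> u) ` {0..T})"
    by (intro compact_imp_bounded compact_continuous_image) auto
  then obtain B where "\<forall>x\<in>(nrm X \<circ> u) ` {0..T}. norm x \<le> B"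
    unfolding bounded_iff by blast
  then have "nrm X (u t) \<le> B" if "t \<in> {0..T}" for t
    using that by (fastforce dest: abs_le_D1)
  then show ?thesis by blast
qed

text \<open>At time 0 every admissible step function has \<open>a = b = 0\<close>, so all
  approximating integrals vanish. This identifies the initial value of \<open>v\<close> with that of
  \<open>u\<^sub>\<epsilon>\<close>, which is the one in the initial-data event.\<close>

lemma stochastic_integral_0:
  assumes "stochastic_integral M W 0 \<Psi> I"
  shows "AE \<omega> in M. I \<omega> = 0"
proof -
  have I: "I \<in> borel_measurable M" using assms by (simp add: stochastic_integral_def)
  obtain p where p: "\<And>n. \<forall>(a, b, x, y)\<in>set (p n). 0 \<le> a \<and> a \<le> b \<and> b \<le> 0"
    "(\<lambda>n. \<integral>\<^sup>+ \<omega>. ennreal ((norm (I \<omega> - step_integral W (p n) \<omega>))\<^sup>2) \<partial>M) \<longlonglongrightarrow> 0"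
    using assms unfolding stochastic_integral_def by blast
  have "step_integral W (p n) \<omega> = 0" for n \<omega>
  proof -
    have "(\<lambda>(a, b, x, y). (W b x \<omega> - W a x \<omega>) *\<^sub>R y) v = 0" if "v \<in> set (p n)" for v
    proof -
      obtain a b x y where v: "v = (a, b, x, y)" by (cases v)
      with p(1)[of n] that have "a = b" by fastforce
      then show ?thesis by (simp add: v)
    qed
    then have "map (\<lambda>(a, b, x, y). (W b x \<omega> - W a x \<omega>) *\<^sub>R y) (p n) = map (\<lambda>_. 0) (p n)"
      by (intro map_cong refl)
    then show ?thesis unfolding step_integral_def by (simp only: sum_list_0)
  qed
  with p(2) have "(\<lambda>n::nat. \<integral>\<^sup>+ \<omega>. ennreal ((norm (I \<omega>))\<^sup>2) \<partial>M) \<longlonglongrightarrow> 0" by simp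
  then have "(\<integral>\<^sup>+ \<omega>. ennreal ((norm (I \<omega>))\<^sup>2) \<partial>M) = 0"
    using LIMSEQ_unique tendsto_const by blast
  then have "AE \<omega> in M. ennreal ((norm (I \<omega>))\<^sup>2) = 0"
    using I by (subst (asm) nn_integral_0_iff_AE) auto
  then show ?thesis by eventually_elim simp
qed

text \<open>Each event has a measurable cover of the same outer measure, so subadditivity holds
  without measurability of the events; the exceptional null set joins the covers at no cost.\<close>

lemma outer_prob_le_add3:
  assumes "AE \<omega> in M. P \<omega> \<longrightarrow> P1 \<omega> \<or> P2 \<omega> \<or> P3 \<omega>"
  shows "outer_prob M P \<le> outer_prob M P1 + outer_prob M P2 + outer_prob M P3"
proof -
  obtain N where N: "N \<in> null_sets M" "{\<omega> \<in> space M. \<not> (P \<omega> \<longrightarrow> P1 \<omega> \<or> P2 \<omega> \<or> P3 \<omega>)} \<subseteq> N"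
    using assms unfolding eventually_ae_filter by blast
  have cover: "\<exists>B\<in>sets M. {\<omega> \<in> space M. Q \<omega>} \<subseteq> B \<and> outer_prob M Q = emeasure M B" for Q
    unfolding outer_prob_def using outer_measure_of_attain[of "{\<omega> \<in> space M. Q \<omega>}" M] by auto
  obtain B1 B2 B3 where B: "B1 \<in> sets M" "B2 \<in> sets M" "B3 \<in> sets M"
    "{\<omega> \<in> space M. P1 \<omega>} \<subseteq> B1" "{\<omega> \<in> space M. P2 \<omega>} \<subseteq> B2" "{\<omega> \<in> space M. P3 \<omega>} \<subseteq> B3"
    "outer_prob M P1 = emeasure M B1" "outer_prob M P2 = emeasure M B2" "outer_prob M P3 = emeasure M B3"
    using cover[of P1] cover[of P2] cover[of P3] by blast
  have "{\<omega> \<in> space M. P \<omega>} \<subseteq> B1 \<union> B2 \<union> B3 \<union> N" using N(2) B(4-6) by auto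
  then have "outer_prob M P \<le> emeasure M (B1 \<union> B2 \<union> B3 \<union> N)"
    unfolding outer_prob_def outer_measure_of_def using B N by (intro INF_lower) auto
  also have "\<dots> = emeasure M (B1 \<union> B2 \<union> B3)"
    using B N by (intro emeasure_Un_null_set) auto
  also have "\<dots> \<le> emeasure M (B1 \<union> B2) + emeasure M B3"
    using B by (intro emeasure_subadditive) auto
  also have "\<dots> \<le> emeasure M B1 + emeasure M B2 + emeasure M B3"
    using B by (intro add_right_mono emeasure_subadditive) auto
  finally show ?thesis by (simp add: B)
qed

theorem theorem3p9:
  fixes M :: "'w measure"
    and W :: "real \<Rightarrow> 'k::{real_inner, banach, second_countable_topology} \<Rightarrow> 'w \<Rightarrow> real"
    and X V :: "'h::{real_inner, banach, second_countable_topology} normed_sub"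
    and V\<^sub>\<epsilon> :: "real \<Rightarrow> 'h normed_sub"
    and A G :: "'h \<Rightarrow> 'h \<Rightarrow> real"
    and A\<^sub>\<epsilon> F\<^sub>\<epsilon> :: "real \<Rightarrow> 'h \<Rightarrow> 'h \<Rightarrow> real"
    and S\<^sub>\<epsilon> :: "real \<Rightarrow> real \<Rightarrow> 'h \<Rightarrow>\<^sub>L 'h"
    and D\<^sub>\<epsilon> :: "real \<Rightarrow> 'k set"
    and Q\<^sub>\<epsilon> :: "real \<Rightarrow> 'k \<Rightarrow> 'h"
    and Z\<^sub>\<epsilon> u\<^sub>\<epsilon> :: "real \<Rightarrow> real \<Rightarrow> 'w \<Rightarrow> 'h"
    and u :: "real \<Rightarrow> 'h" and u\<^sub>0 :: 'h
    and c\<^sub>\<epsilon> :: "real \<Rightarrow> real" and C \<delta> T :: real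
  assumes "cylindrical_wiener M W"
    and "gelfand_triple V X"
    and "\<forall>\<epsilon>>0. gelfand_triple (V\<^sub>\<epsilon> \<epsilon>) X"
    and "linear_to_dual V A" and "A \<in> measurable (nborel V) (dual_borel V)"
    and "\<forall>\<epsilon>>0. linear_to_dual (V\<^sub>\<epsilon> \<epsilon>) (A\<^sub>\<epsilon> \<epsilon>) \<and>
               A\<^sub>\<epsilon> \<epsilon> \<in> measurable (nborel (V\<^sub>\<epsilon> \<epsilon>)) (dual_borel (V\<^sub>\<epsilon> \<epsilon>))"
    and "G \<in> measurable (nborel X) (dual_borel V)"
    and "\<forall>\<epsilon>>0. F\<^sub>\<epsilon> \<epsilon> \<in> measurable (nborel X) (dual_borel (V\<^sub>\<epsilon> \<epsilon>))"
    and "\<forall>\<epsilon>>0. generates_C0_semigroup (V\<^sub>\<epsilon> \<epsilon>) (A\<^sub>\<epsilon> \<epsilon>) (S\<^sub>\<epsilon> \<epsilon>)"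
    and "\<forall>\<epsilon>>0. densely_defined_operator (D\<^sub>\<epsilon> \<epsilon>) (Q\<^sub>\<epsilon> \<epsilon>)"
    and "\<forall>\<epsilon>>0. \<forall>t\<ge>0. stochastic_convolution M W (S\<^sub>\<epsilon> \<epsilon>) (D\<^sub>\<epsilon> \<epsilon>) (Q\<^sub>\<epsilon> \<epsilon>) t (Z\<^sub>\<epsilon> \<epsilon> t)"
    and "\<forall>\<epsilon>>0. \<forall>T'>0. AE \<omega> in M. C0_in X T' (\<lambda>t. Z\<^sub>\<epsilon> \<epsilon> t \<omega>)"
    and "T > 0"
    and "weak_solution V T A (\<lambda>s. G) u\<^sub>0 u"
    and "regular V T u" and "C0_in X T u"
    and "\<forall>\<epsilon>>0. AE \<omega> in M.
           weak_solution (V\<^sub>\<epsilon> \<epsilon>) T (A\<^sub>\<epsilon> \<epsilon>) (\<lambda>s v. F\<^sub>\<epsilon> \<epsilon> (v + Z\<^sub>\<epsilon> \<epsilon> s \<omega>))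
             (u\<^sub>\<epsilon> \<epsilon> 0 \<omega> - Z\<^sub>\<epsilon> \<epsilon> 0 \<omega>) (\<lambda>t. u\<^sub>\<epsilon> \<epsilon> t \<omega> - Z\<^sub>\<epsilon> \<epsilon> t \<omega>)"
    and "\<forall>\<epsilon>>0. AE \<omega> in M.
           regular (V\<^sub>\<epsilon> \<epsilon>) T (\<lambda>t. u\<^sub>\<epsilon> \<epsilon> t \<omega> - Z\<^sub>\<epsilon> \<epsilon> t \<omega>) \<and>
           C0_in X T (\<lambda>t. u\<^sub>\<epsilon> \<epsilon> t \<omega> - Z\<^sub>\<epsilon> \<epsilon> t \<omega>)"
    and "\<forall>\<epsilon>>0. AE \<omega> in M. regular (V\<^sub>\<epsilon> \<epsilon>) T (\<lambda>t. u t - (u\<^sub>\<epsilon> \<epsilon> t \<omega> - Z\<^sub>\<epsilon> \<epsilon> t \<omega>))"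
    and "C \<ge> 0" and "\<delta> > 0"
    and "\<forall>\<epsilon>>0. c\<^sub>\<epsilon> \<epsilon> \<ge> 0" and "(c\<^sub>\<epsilon> \<longlongrightarrow> 0) (at_right 0)"
    and "\<forall>\<epsilon>>0. \<forall>\<phi>\<in>carr (V\<^sub>\<epsilon> \<epsilon>). \<forall>\<psi>\<in>carr X. c\<^sub>\<epsilon> \<epsilon> * nrm X \<psi> \<le> 1 \<longrightarrow>
           A\<^sub>\<epsilon> \<epsilon> \<phi> \<phi> + (F\<^sub>\<epsilon> \<epsilon> (\<phi> + \<psi>) \<phi> - F\<^sub>\<epsilon> \<epsilon> \<psi> \<phi>)
             \<le> - \<delta> * (nrm (V\<^sub>\<epsilon> \<epsilon>) \<phi>)\<^sup>2 + C * (norm \<phi>)\<^sup>2"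
  shows "\<exists>K>0. \<forall>\<^sub>F \<epsilon> in at_right 0. \<forall>\<gamma>>0.
           outer_prob M (\<lambda>\<omega>. (SUP t\<in>{0..T}. ennreal ((norm (u\<^sub>\<epsilon> \<epsilon> t \<omega> - u t - Z\<^sub>\<epsilon> \<epsilon> t \<omega>))\<^sup>2)) > ennreal (K * \<gamma>))
           \<le> outer_prob M (\<lambda>\<omega>. (SUP t\<in>{0..T}. enorm X (Z\<^sub>\<epsilon> \<epsilon> t \<omega>)) > inverse (ennreal (2 * c\<^sub>\<epsilon> \<epsilon>)))
             + outer_prob M (\<lambda>\<omega>. (norm (u 0 - u\<^sub>\<epsilon> \<epsilon> 0 \<omega>))\<^sup>2 > \<gamma>)
             + outer_prob M (\<lambda>\<omega>. residual_sq_integral (V\<^sub>\<epsilon> \<epsilon>) X T (A\<^sub>\<epsilon> \<epsilon>) (F\<^sub>\<epsilon> \<epsilon>) u (\<lambda>t. Z\<^sub>\<epsilon> \<epsilon> t \<omega>) > ennreal \<gamma>)"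
proof -
  obtain B0 where B0: "\<forall>t\<in>{0..T}. nrm X (u t) \<le> B0"
    using C0_in_nrm_bounded[OF gelfand_triple_banach_sub(2)[OF assms(2)] assms(16)] by blast
  \<comment> \<open>The maximum with 1 makes the bound positive, so \<open>1 / (2 * B)\<close> is a
    valid threshold.\<close>
  define B where "B = max 1 B0"
  have B: "B > 0" "\<And>t. t \<in> {0..T} \<Longrightarrow> nrm X (u t) \<le> B"
    using B0 by (auto simp: B_def le_max_iff_disj)
  \<comment> \<open>The pathwise bound at time \<open>T\<close> with both the initial error and the
    residual integral replaced by \<gamma>, divided by \<gamma>.\<close>
  define K where "K = (1 + 1 / (2 * \<delta>)) * exp (2 * C * T)"
  have K: "K > 0" using \<open>\<delta> > 0\<close> by (simp add: K_def add_pos_pos)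
  \<comment> \<open>Half of the admissible size of the base point goes to \<open>u\<close>; the
    other half is the threshold \<open>1 / (2c)\<close> for the noise.\<close>
  have "\<forall>\<^sub>F \<epsilon> in at_right 0. c\<^sub>\<epsilon> \<epsilon> < 1 / (2 * B)"
    using assms(23) B(1) by (intro order_tendstoD(2)) auto
  then have "\<forall>\<^sub>F \<epsilon> in at_right 0. 0 < \<epsilon> \<and> c\<^sub>\<epsilon> \<epsilon> < 1 / (2 * B)"
    using eventually_at_right_less by eventually_elim simp
  then have main: "\<forall>\<^sub>F \<epsilon> in at_right 0. \<forall>\<gamma>>0.
           outer_prob M (\<lambda>\<omega>. (SUP t\<in>{0..T}. ennreal ((norm (u\<^sub>\<epsilon> \<epsilon> t \<omega> - u t - Z\<^sub>\<epsilon> \<epsilon> t \<omega>))\<^sup>2)) > ennreal (K * \<gamma>))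
           \<le> outer_prob M (\<lambda>\<omega>. (SUP t\<in>{0..T}. enorm X (Z\<^sub>\<epsilon> \<epsilon> t \<omega>)) > inverse (ennreal (2 * c\<^sub>\<epsilon> \<epsilon>)))
             + outer_prob M (\<lambda>\<omega>. (norm (u 0 - u\<^sub>\<epsilon> \<epsilon> 0 \<omega>))\<^sup>2 > \<gamma>)
             + outer_prob M (\<lambda>\<omega>. residual_sq_integral (V\<^sub>\<epsilon> \<epsilon>) X T (A\<^sub>\<epsilon> \<epsilon>) (F\<^sub>\<epsilon> \<epsilon>) u (\<lambda>t. Z\<^sub>\<epsilon> \<epsilon> t \<omega>) > ennreal \<gamma>)"
  proof (eventually_elim, intro allI impI outer_prob_le_add3)
    fix \<epsilon> \<gamma> :: real
    assume \<epsilon>: "0 < \<epsilon> \<and> c\<^sub>\<epsilon> \<epsilon> < 1 / (2 * B)" and \<gamma>: "0 < \<gamma>"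
    have triple: "gelfand_triple (V\<^sub>\<epsilon> \<epsilon>) X" using assms(3) \<epsilon> by blast
    have bX: "banach_sub X" by (rule gelfand_triple_banach_sub[OF triple])
    have c: "0 \<le> c\<^sub>\<epsilon> \<epsilon>" "c\<^sub>\<epsilon> \<epsilon> * B \<le> 1 / 2"
      using assms(22) \<epsilon> B(1) by (auto simp: field_simps)
    obtain \<Psi> where "stochastic_integral M W 0 \<Psi> (Z\<^sub>\<epsilon> \<epsilon> 0)"
      using assms(11) \<epsilon> unfolding stochastic_convolution_def by blast
    then have Z0: "AE \<omega> in M. Z\<^sub>\<epsilon> \<epsilon> 0 \<omega> = 0" by (rule stochastic_integral_0)
    have "AE \<omega> in M. C0_in X T (\<lambda>t. Z\<^sub>\<epsilon> \<epsilon> t \<omega>)" using assms(12,13) \<epsilon> by blast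
    moreover have "AE \<omega> in M. weak_solution (V\<^sub>\<epsilon> \<epsilon>) T (A\<^sub>\<epsilon> \<epsilon>) (\<lambda>s v. F\<^sub>\<epsilon> \<epsilon> (v + Z\<^sub>\<epsilon> \<epsilon> s \<omega>))
        (u\<^sub>\<epsilon> \<epsilon> 0 \<omega> - Z\<^sub>\<epsilon> \<epsilon> 0 \<omega>) (\<lambda>t. u\<^sub>\<epsilon> \<epsilon> t \<omega> - Z\<^sub>\<epsilon> \<epsilon> t \<omega>)"
      using assms(17) \<epsilon> by blast
    moreover have "AE \<omega> in M. regular (V\<^sub>\<epsilon> \<epsilon>) T (\<lambda>t. u\<^sub>\<epsilon> \<epsilon> t \<omega> - Z\<^sub>\<epsilon> \<epsilon> t \<omega>) \<and>
        C0_in X T (\<lambda>t. u\<^sub>\<epsilon> \<epsilon> t \<omega> - Z\<^sub>\<epsilon> \<epsilon> t \<omega>)"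
      using assms(18) \<epsilon> by blast
    moreover have "AE \<omega> in M. regular (V\<^sub>\<epsilon> \<epsilon>) T (\<lambda>t. u t - (u\<^sub>\<epsilon> \<epsilon> t \<omega> - Z\<^sub>\<epsilon> \<epsilon> t \<omega>))"
      using assms(19) \<epsilon> by blast
    ultimately show "AE \<omega> in M. (SUP t\<in>{0..T}. ennreal ((norm (u\<^sub>\<epsilon> \<epsilon> t \<omega> - u t - Z\<^sub>\<epsilon> \<epsilon> t \<omega>))\<^sup>2)) > ennreal (K * \<gamma>) \<longrightarrow>
        (SUP t\<in>{0..T}. enorm X (Z\<^sub>\<epsilon> \<epsilon> t \<omega>)) > inverse (ennreal (2 * c\<^sub>\<epsilon> \<epsilon>)) \<or>
        (norm (u 0 - u\<^sub>\<epsilon> \<epsilon> 0 \<omega>))\<^sup>2 > \<gamma> \<or>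
        residual_sq_integral (V\<^sub>\<epsilon> \<epsilon>) X T (A\<^sub>\<epsilon> \<epsilon>) (F\<^sub>\<epsilon> \<epsilon>) u (\<lambda>t. Z\<^sub>\<epsilon> \<epsilon> t \<omega>) > ennreal \<gamma>"
      using Z0
    proof eventually_elim
      case (elim \<omega>)
      let ?z = "\<lambda>t. Z\<^sub>\<epsilon> \<epsilon> t \<omega>" and ?v = "\<lambda>t. u\<^sub>\<epsilon> \<epsilon> t \<omega> - Z\<^sub>\<epsilon> \<epsilon> t \<omega>"
      \<comment> \<open>Contrapositive: off the three bad events the pathwise estimate
        applies.\<close>
      have "(SUP t\<in>{0..T}. ennreal ((norm (u\<^sub>\<epsilon> \<epsilon> t \<omega> - u t - Z\<^sub>\<epsilon> \<epsilon> t \<omega>))\<^sup>2)) \<le> ennreal (K * \<gamma>)"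
        if z: "(SUP t\<in>{0..T}. enorm X (?z t)) \<le> inverse (ennreal (2 * c\<^sub>\<epsilon> \<epsilon>))"
          and init: "(norm (u 0 - u\<^sub>\<epsilon> \<epsilon> 0 \<omega>))\<^sup>2 \<le> \<gamma>"
          and res: "residual_sq_integral (V\<^sub>\<epsilon> \<epsilon>) X T (A\<^sub>\<epsilon> \<epsilon>) (F\<^sub>\<epsilon> \<epsilon>) u ?z \<le> ennreal \<gamma>"
      proof (rule SUP_least, rule ennreal_leI)
        fix t assume t: "t \<in> {0..T}"
        have small: "c\<^sub>\<epsilon> \<epsilon> * nrm X (u t + ?z t) \<le> 1" if t: "t \<in> {0..T}" for t
        proof -
          have uX: "u t \<in> carr X" and zX: "?z t \<in> carr X"
            using C0_in_carr[OF bX _ t] assms(16) elim(1) by auto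
          have "c\<^sub>\<epsilon> \<epsilon> * nrm X (?z t) \<le> 1 / 2"
          \<comment> \<open>If the constant is zero, the noise threshold is
            \<open>inverse 0 = \<infinity>\<close> in \<open>ennreal\<close> and gives no bound on
            the norm, but the product is zero anyway.\<close>
          proof (cases "c\<^sub>\<epsilon> \<epsilon> = 0")
            case False
            then have "inverse (ennreal (2 * c\<^sub>\<epsilon> \<epsilon>)) = ennreal (inverse (2 * c\<^sub>\<epsilon> \<epsilon>))"
              using c(1) by (intro inverse_ennreal) simp
            moreover have "enorm X (?z t) \<le> inverse (ennreal (2 * c\<^sub>\<epsilon> \<epsilon>))"
              by (rule order_trans[OF SUP_upper[OF t] z])
            ultimately have "nrm X (?z t) \<le> inverse (2 * c\<^sub>\<epsilon> \<epsilon>)"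
              using zX c(1) by (simp add: enorm_def ennreal_le_iff)
            then show ?thesis using False c(1) by (simp add: field_simps)
          qed simp
          moreover have "c\<^sub>\<epsilon> \<epsilon> * nrm X (u t) \<le> 1 / 2"
            using mult_left_mono[OF B(2)[OF t] c(1)] c(2) by linarith
          moreover have "c\<^sub>\<epsilon> \<epsilon> * nrm X (u t + ?z t) \<le> c\<^sub>\<epsilon> \<epsilon> * (nrm X (u t) + nrm X (?z t))"
            by (intro mult_left_mono banach_sub_nrm_add bX uX zX c)
          ultimately show ?thesis by (simp add: distrib_left)
        qed
        have "(norm (u t - ?v t))\<^sup>2 \<le> ((norm (u 0 - ?v 0))\<^sup>2 + \<gamma> / (2 * \<delta>)) * exp (2 * C * t)"
        proof (rule pathwise_estimate[OF triple \<open>T > 0\<close> _ _ _ assms(16) _ elim(1) elim(2) elim(4)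
              \<open>\<delta> > 0\<close> \<open>C \<ge> 0\<close> small _ _ res t])
          show "A\<^sub>\<epsilon> \<epsilon> \<phi> \<phi> + (F\<^sub>\<epsilon> \<epsilon> (\<phi> + \<psi>) \<phi> - F\<^sub>\<epsilon> \<epsilon> \<psi> \<phi>) \<le> - \<delta> * (nrm (V\<^sub>\<epsilon> \<epsilon>) \<phi>)\<^sup>2 + C * (norm \<phi>)\<^sup>2"
            if "\<phi> \<in> carr (V\<^sub>\<epsilon> \<epsilon>)" "\<psi> \<in> carr X" "c\<^sub>\<epsilon> \<epsilon> * nrm X \<psi> \<le> 1" for \<phi> \<psi>
            using assms(24) \<epsilon> that by blast
        qed (use assms(6,8) \<epsilon> elim \<gamma> in auto)
        \<comment> \<open>The stochastic convolution vanishes at time 0, so \<open>?v 0\<close> is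
          the initial value of \<open>u\<^sub>\<epsilon>\<close> and \<open>init\<close>
          applies.\<close>
        also have "\<dots> \<le> (\<gamma> + \<gamma> / (2 * \<delta>)) * exp (2 * C * T)"
          using init elim(5) t \<gamma> \<open>\<delta> > 0\<close> \<open>C \<ge> 0\<close>
          by (intro mult_mono add_mono) (auto intro: mult_left_mono add_nonneg_nonneg)
        also have "\<dots> = K * \<gamma>" by (simp add: K_def algebra_simps)
        also have "u t - ?v t = - (u\<^sub>\<epsilon> \<epsilon> t \<omega> - u t - Z\<^sub>\<epsilon> \<epsilon> t \<omega>)" by simp
        finally show "(norm (u\<^sub>\<epsilon> \<epsilon> t \<omega> - u t - Z\<^sub>\<epsilon> \<epsilon> t \<omega>))\<^sup>2 \<le> K * \<gamma>"
          by (simp only: norm_minus_cancel)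
      qed
      then show ?case by (meson not_le)
    qed
  qed
  show ?thesis using K main by blast
qed

end
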